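(* Let $k\ge 4$ be an integer and let $r>0$, $L_{e_1}>0$. Let $(\hat{\mathsf{Star}}_k)^2_r$ be the second configuration space with restraint parameter $r$ of the metric star graph $\hat{\mathsf{Star}}_k$ with $k$ edges, in which the edge $e_1$ has length $L_{e_1}$ and every other edge has length $1$. Then $$\operatorname{rank} H_0((\hat{\mathsf{Star}}_k)^2_r)=\begin{cases}1,& r\le 1\\ k^2-3k+4,& 1<r\le 2 \text{ and } r\le L_{e_1}\\ k^2-k,& 1<r\le 2\text{ and } L_{e_1}<r\le L_{e_1}+1\\ k^2-3k+2,& 1<r\le 2\text{ and } L_{e_1}+1<r\\ 2,& 2<r\text{ and } r\le L_{e_1}\\ 2k-2,& 2<r\text{ and } L_{e_1}<r\le L_{e_1}+1\\ 0,&\text{else}\end{cases}$$ and $$\operatorname{rank} H_1((\hat{\mathsf{Star}}_k)^2_r)=\begin{cases}k^2-3k+1,& r\le 1\text{ and } r\le L_{e_1}\\ k^2-5k+5,& r\le 1\text{ and } L_{e_1}<r\le L_{e_1}+1\\ 0,&\text{else.}\end{cases}$$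
   Context: The star graph with $k$ edges is the tree with one central vertex and $k$ edges $e_1,\dots,e_k$, each joining the central vertex to a leaf; as a metric graph it carries the path metric $\delta$ determined by the edge lengths. For a metric graph $(X,\delta)$ and $r>0$, $X^2_r=\{(x,y)\in X\times X\mid \delta(x,y)\ge r\}$ (subspace topology). Homology is singular homology with integer coefficients, and rank is the rank of an abelian group. *)

theory Defs
  imports "HOL-Analysis.Analysis" "HOL-Homology.Homology"
begin

section \<open>Metric graphs\<close>

text \<open>The orientation of edges (\<open>src\<close> to \<open>tgt\<close>) only serves to parametrise the edge \<open>e\<close> by
  \<open>{0..len e}\<close>; it plays no role for the metric.\<close>

record ('v, 'e) metric_graph =
  verts :: "'v set"
  edges :: "'e set"
  src :: "'e \<Rightarrow> 'v"
  tgt :: "'e \<Rightarrow> 'v"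
  len :: "'e \<Rightarrow> real"

datatype ('v, 'e) gpoint = Vertex 'v | Inner 'e real

definition graph_points :: "('v, 'e) metric_graph \<Rightarrow> ('v, 'e) gpoint set" where
  "graph_points G = Vertex ` verts G \<union> {Inner e t | e t. e \<in> edges G \<and> 0 < t \<and> t < len G e}"

text \<open>The characteristic map \<open>{0..len e} \<rightarrow> |G|\<close> of the edge \<open>e\<close>.\<close>

definition edge_point :: "('v, 'e) metric_graph \<Rightarrow> 'e \<Rightarrow> real \<Rightarrow> ('v, 'e) gpoint" where
  "edge_point G e t =
    (if t \<le> 0 then Vertex (src G e) else if len G e \<le> t then Vertex (tgt G e) else Inner e t)"

text \<open>\<open>joined G x l y\<close>: some path from \<open>x\<close> to \<open>y\<close>, composed of finitely many segments each
  running inside a single edge, has total length \<open>l\<close>.\<close>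

inductive joined :: "('v, 'e) metric_graph \<Rightarrow> ('v, 'e) gpoint \<Rightarrow> real \<Rightarrow> ('v, 'e) gpoint \<Rightarrow> bool"
  for G where
  refl: "x \<in> graph_points G \<Longrightarrow> joined G x 0 x"
| step: "\<lbrakk>joined G x l (edge_point G e s); e \<in> edges G; s \<in> {0..len G e}; t \<in> {0..len G e}\<rbrakk>
    \<Longrightarrow> joined G x (l + \<bar>s - t\<bar>) (edge_point G e t)"

text \<open>The value \<open>0\<close> for points that are not joined by a path is a dummy; it never occurs between
  points of a connected graph, but makes the function nonnegative everywhere, as the locale
  \<^locale>\<open>Metric_space\<close> requires.\<close>

definition path_dist ::
    "('v, 'e) metric_graph \<Rightarrow> ('v, 'e) gpoint \<Rightarrow> ('v, 'e) gpoint \<Rightarrow> real" where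
  "path_dist G x y = (if \<exists>l. joined G x l y then Inf {l. joined G x l y} else 0)"

definition graph_topology :: "('v, 'e) metric_graph \<Rightarrow> ('v, 'e) gpoint topology" where
  "graph_topology G = Metric_space.mtopology (graph_points G) (path_dist G)"

definition config_space2 ::
    "('v, 'e) metric_graph \<Rightarrow> real \<Rightarrow> (('v, 'e) gpoint \<times> ('v, 'e) gpoint) topology" where
  "config_space2 G r =
    subtopology (prod_topology (graph_topology G) (graph_topology G))
      {(x, y). x \<in> graph_points G \<and> y \<in> graph_points G \<and> r \<le> path_dist G x y}"

section \<open>Star graphs\<close>

text \<open>The centre is \<open>0\<close>; edge \<open>i\<close> joins it to the leaf \<open>i\<close>, for \<open>1 \<le> i \<le> k\<close>.\<close>

definition star_graph :: "nat \<Rightarrow> (nat \<Rightarrow> real) \<Rightarrow> (nat, nat) metric_graph" where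
  "star_graph k w = \<lparr>verts = {0..k}, edges = {1..k}, src = (\<lambda>i. 0), tgt = (\<lambda>i. i), len = w\<rparr>"

definition star_hat :: "nat \<Rightarrow> real \<Rightarrow> (nat, nat) metric_graph" where
  "star_hat k L = star_graph k (\<lambda>i. if i = 1 then L else 1)"

section \<open>Rank of an abelian group\<close>

definition int_independent :: "('a, 'b) monoid_scheme \<Rightarrow> 'a set \<Rightarrow> bool" where
  "int_independent G S \<longleftrightarrow> S \<subseteq> carrier G \<and> finite S \<and>
    (\<forall>c :: 'a \<Rightarrow> int. finprod G (\<lambda>x. x [^]\<^bsub>G\<^esub> c x) S = \<one>\<^bsub>G\<^esub> \<longrightarrow> (\<forall>x\<in>S. c x = 0))"

text \<open>The supremum over finite independent sets, in \<^typ>\<open>enat\<close>, so that infinite rank is \<open>\<infinity>\<close>.\<close>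

definition abelian_rank :: "('a, 'b) monoid_scheme \<Rightarrow> enat" where
  "abelian_rank G = Sup {enat (card S) | S. int_independent G S}"

section \<open>Sanity checks: the path metric of a star\<close>

fun star_arm :: "(nat, nat) gpoint \<Rightarrow> nat" where
  "star_arm (Vertex v) = v"
| "star_arm (Inner e t) = e"

fun star_height :: "(nat \<Rightarrow> real) \<Rightarrow> (nat, nat) gpoint \<Rightarrow> real" where
  "star_height w (Vertex v) = (if v = 0 then 0 else w v)"
| "star_height w (Inner e t) = t"

definition star_dist :: "(nat \<Rightarrow> real) \<Rightarrow> (nat, nat) gpoint \<Rightarrow> (nat, nat) gpoint \<Rightarrow> real" where
  "star_dist w x y = (if star_arm x = star_arm y then \<bar>star_height w x - star_height w y\<bar>
     else star_height w x + star_height w y)"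

lemma edge_point_star: "edge_point (star_graph k w) i t =
    (if t \<le> 0 then Vertex 0 else if w i \<le> t then Vertex i else Inner i t)"
  by (simp add: edge_point_def star_graph_def)

lemma graph_points_star: "graph_points (star_graph k w) =
    Vertex ` {0..k} \<union> {Inner i t | i t. 1 \<le> i \<and> i \<le> k \<and> 0 < t \<and> t < w i}"
  by (auto simp: graph_points_def star_graph_def)

lemma star_point_cases:
  assumes "x \<in> graph_points (star_graph k w)" "1 \<le> k" "\<And>i. 0 < w i"
  obtains i t where "1 \<le> i" "i \<le> k" "0 \<le> t" "t \<le> w i" "x = edge_point (star_graph k w) i t"
proof (cases x)
  case (Vertex v)
  show ?thesis
  proof (cases "v = 0")
    case True
    then show ?thesis using that[of 1 0] assms Vertex less_imp_le[OF assms(3)]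
      by (simp add: edge_point_star)
  next
    case False
    then show ?thesis using that[of v "w v"] assms Vertex less_imp_le[OF assms(3)]
      by (auto simp: edge_point_star graph_points_star not_le)
  qed
next
  case (Inner i t)
  then show ?thesis using that[of i t] assms
    by (auto simp: edge_point_star graph_points_star)
qed

lemma star_height_nonneg:
  assumes "x \<in> graph_points (star_graph k w)" "\<And>i. 0 < w i"
  shows "0 \<le> star_height w x"
  using assms by (auto simp: graph_points_star less_imp_le)

lemma edge_point_star_in_points:
  assumes "1 \<le> i" "i \<le> k"
  shows "edge_point (star_graph k w) i t \<in> graph_points (star_graph k w)"
  using assms by (auto simp: edge_point_star graph_points_star)

lemma star_dist_edge:
  assumes "\<And>i. 0 < w i" "1 \<le> i" "1 \<le> j" "0 \<le> s" "s \<le> w i" "0 \<le> t" "t \<le> w j"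
  shows "star_dist w (edge_point (star_graph k w) i s) (edge_point (star_graph k w) j t) =
    (if i = j then \<bar>s - t\<bar> else s + t)"
  using assms(1)[of i] assms(1)[of j] assms(2-)
  by (auto simp: star_dist_def edge_point_star)

lemma star_dist_triangle:
  assumes "x \<in> graph_points (star_graph k w)" "y \<in> graph_points (star_graph k w)"
    "z \<in> graph_points (star_graph k w)" "\<And>i. 0 < w i"
  shows "star_dist w x z \<le> star_dist w x y + star_dist w y z"
  using star_height_nonneg[OF assms(1,4)] star_height_nonneg[OF assms(2,4)]
    star_height_nonneg[OF assms(3,4)]
  by (auto simp: star_dist_def)

lemma joined_star_lower:
  assumes "joined (star_graph k w) x l y" "\<And>i. 0 < w i"
  shows "x \<in> graph_points (star_graph k w) \<and> y \<in> graph_points (star_graph k w) \<and>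
    star_dist w x y \<le> l"
  using assms(1)
proof induction
  case (refl x)
  then show ?case by (simp add: star_dist_def)
next
  case (step x l i s t)
  let ?p = "edge_point (star_graph k w) i"
  have i: "1 \<le> i" "i \<le> k" and st: "0 \<le> s" "s \<le> w i" "0 \<le> t" "t \<le> w i"
    using step by (auto simp: star_graph_def)
  have "star_dist w x (?p t) \<le> star_dist w x (?p s) + star_dist w (?p s) (?p t)"
    using step.IH i assms(2) star_dist_triangle[of x k w "?p s" "?p t"]
      edge_point_star_in_points[OF i, of w t] by simp
  moreover have "star_dist w (?p s) (?p t) = \<bar>s - t\<bar>"
    using star_dist_edge[of w i i s t k] assms(2) i st by simp
  ultimately show ?case
    using step.IH edge_point_star_in_points[OF i] by auto
qed

lemma joined_star_attained:
  assumes "\<And>i. 0 < w i" "1 \<le> k"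
    "x \<in> graph_points (star_graph k w)" "y \<in> graph_points (star_graph k w)"
  shows "joined (star_graph k w) x (star_dist w x y) y"
proof -
  let ?G = "star_graph k w"
  obtain i s where x: "1 \<le> i" "i \<le> k" "0 \<le> s" "s \<le> w i" "x = edge_point ?G i s"
    using star_point_cases[OF assms(3,2,1)] by metis
  obtain j t where y: "1 \<le> j" "j \<le> k" "0 \<le> t" "t \<le> w j" "y = edge_point ?G j t"
    using star_point_cases[OF assms(4,2,1)] by metis
  have G: "edges ?G = {1..k}" "len ?G = w" by (simp_all add: star_graph_def)
  have start: "joined ?G x 0 (edge_point ?G i s)"
    using joined.refl[OF assms(3)] x(5) by simp
  show ?thesis
  proof (cases "i = j")
    case True
    have "joined ?G x (0 + \<bar>s - t\<bar>) (edge_point ?G i t)"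
      using joined.step[OF start] x y True by (simp add: G)
    then show ?thesis using star_dist_edge[of w i j s t k] assms(1) x y True by simp
  next
    case False
    have "joined ?G x (0 + \<bar>s - 0\<bar>) (edge_point ?G i 0)"
      using joined.step[OF start, of 0] x less_imp_le[OF assms(1)] by (simp add: G)
    moreover have "edge_point ?G i 0 = edge_point ?G j 0"
      by (simp add: edge_point_star)
    ultimately have "joined ?G x s (edge_point ?G j 0)"
      using x(3) by simp
    then have "joined ?G x (s + \<bar>0 - t\<bar>) (edge_point ?G j t)"
      using joined.step[of ?G x s j 0 t] y less_imp_le[OF assms(1)] by (simp add: G)
    then show ?thesis using star_dist_edge[of w i j s t k] assms(1) x y False by simp
  qed
qed

lemma path_dist_star:
  assumes "\<And>i. 0 < w i" "1 \<le> k"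
    "x \<in> graph_points (star_graph k w)" "y \<in> graph_points (star_graph k w)"
  shows "path_dist (star_graph k w) x y = star_dist w x y"
proof -
  have "Inf {l. joined (star_graph k w) x l y} = star_dist w x y"
    using joined_star_attained[OF assms] joined_star_lower[OF _ assms(1)]
    by (intro cInf_eq_minimum) auto
  then show ?thesis
    using joined_star_attained[OF assms] by (auto simp: path_dist_def)
qed

lemma Metric_space_star:
  assumes "\<And>i. 0 < w i" "1 \<le> k"
  shows "Metric_space (graph_points (star_graph k w)) (path_dist (star_graph k w))"
proof -
  let ?G = "star_graph k w"
  have out: "path_dist ?G x y = 0" if "x \<notin> graph_points ?G \<or> y \<notin> graph_points ?G" for x y
    using that joined_star_lower[OF _ assms(1)] by (auto simp: path_dist_def)
  show ?thesis
  proof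
    fix x y
    show "0 \<le> path_dist ?G x y"
      using out[of x y] path_dist_star[of w k x y] assms
        star_height_nonneg[of x k w] star_height_nonneg[of y k w]
      by (cases "x \<in> graph_points ?G \<and> y \<in> graph_points ?G") (auto simp: star_dist_def)
    show "path_dist ?G x y = path_dist ?G y x"
      using out[of x y] out[of y x] path_dist_star[of w k x y]
        path_dist_star[of w k y x] assms
      by (cases "x \<in> graph_points ?G \<and> y \<in> graph_points ?G") (auto simp: star_dist_def)
  next
    fix x y assume xy: "x \<in> graph_points ?G" "y \<in> graph_points ?G"
    obtain i s where x: "1 \<le> i" "i \<le> k" "0 \<le> s" "s \<le> w i" "x = edge_point ?G i s"
      using star_point_cases[OF xy(1) assms(2,1)] by metis
    obtain j t where y: "1 \<le> j" "j \<le> k" "0 \<le> t" "t \<le> w j" "y = edge_point ?G j t"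
      using star_point_cases[OF xy(2) assms(2,1)] by metis
    have "star_dist w x y = (if i = j then \<bar>s - t\<bar> else s + t)"
      using star_dist_edge[of w i j s t k] assms(1) x y by simp
    then have "x = y" if "star_dist w x y = 0"
      using that x y by (auto simp: edge_point_star split: if_splits)
    moreover have "star_dist w x x = 0" by (simp add: star_dist_def)
    ultimately show "(path_dist ?G x y = 0) = (x = y)"
      using path_dist_star[of w k x y] assms xy by auto
  next
    fix x y z assume "x \<in> graph_points ?G" "y \<in> graph_points ?G" "z \<in> graph_points ?G"
    then show "path_dist ?G x z \<le> path_dist ?G x y + path_dist ?G y z"
      using star_dist_triangle assms by (simp add: path_dist_star)
  qed
qed

end

theory Submission
  imports Defs
begin

text \<open>
  Embed the star into coordinate space by sending the point at height \<open>s\<close> on arm \<open>i\<close> to \<open>s\<close> times the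
  \<open>i\<close>-th unit vector; the path metric becomes the \<open>l1\<close> metric. A configuration \<open>(x, y)\<close> at distance
  at least \<open>r\<close> either has its points in the interiors of distinct arms (a \<^emph>\<open>cell\<close>), or lies near a
  configuration whose lower point is at the centre while the other is on an arm of length at
  least \<open>r\<close>. The latter configurations have open neighbourhoods consisting of the pairs in which one
  given point is the higher one and lies on a given arm. Cells, these neighbourhoods, and their
  nonempty intersections are all star-shaped, so Mayer--Vietoris, read on the level of ranks, gives
  the Euler characteristic of a graph. For \<open>r \<le> 1\<close> the space is path-connected; for
  \<open>r > 1\<close> at most arm \<open>1\<close> has length at least \<open>r\<close>, and the space is a disjoint union of star-shaped
  open pieces.
\<close>

section \<open>Rank of abelian groups\<close>

text \<open>Ranks live in \<open>enat\<close> and may a priori be infinite, so exactness is always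
  used as an equation between sums; a difference is formed only at the end, when finiteness is
  known. The numbers in the theorem come from a count. Let n arms have length at least
  \<open>r\<close>. There are 2n neighbourhoods of the arm kind (which point is higher, and on which
  arm), and each meets k - 1 cells, one for every other arm that can carry the lower point. For r <=
  1 all k(k - 1) cells are nonempty, so b1 = 2n(k - 1) + 1 - 2n - k(k - 1): this is k^2 - 3k + 1 for
  n = k and k^2 - 5k + 5 for n = k - 1. The bound k >= 4 guarantees n >= 3 when r <= 1. A third long
  arm is the place where one point can wait while the other changes arms; this is what makes the
  space connected. For r > 1 the cells account for b0, except that those touching a long arm 1
  coalesce with the arm neighbourhoods into two pieces, one for each point that may be far out on
  arm 1.\<close>

definition lincomb :: "('a, 'b) monoid_scheme \<Rightarrow> 'i set \<Rightarrow> ('i \<Rightarrow> 'a) \<Rightarrow> ('i \<Rightarrow> int) \<Rightarrow> 'a" where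
  "lincomb G I g c = finprod G (\<lambda>i. g i [^]\<^bsub>G\<^esub> c i) I"

text \<open>Families instead of sets: a repeated value counts as a dependence, so applying a
  homomorphism to the members cannot hide a collapse.\<close>

definition independent_family :: "('a, 'b) monoid_scheme \<Rightarrow> 'i set \<Rightarrow> ('i \<Rightarrow> 'a) \<Rightarrow> bool" where
  "independent_family G I g \<longleftrightarrow> finite I \<and> g \<in> I \<rightarrow> carrier G \<and>
    (\<forall>c. lincomb G I g c = \<one>\<^bsub>G\<^esub> \<longrightarrow> (\<forall>i\<in>I. c i = 0))"

text \<open>Independence is tested in the ambient \<open>G\<close>, so kernels and images are
  measured without being turned into groups themselves.\<close>

definition rank_on :: "('a, 'b) monoid_scheme \<Rightarrow> 'a set \<Rightarrow> enat" where
  "rank_on G A = Sup {enat (card S) | S. int_independent G S \<and> S \<subseteq> A}"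

lemma int_independent_iff_family: "int_independent G S \<longleftrightarrow> independent_family G S (\<lambda>x. x)"
  by (auto simp: int_independent_def independent_family_def lincomb_def)

lemma abelian_rank_eq_rank_on: "abelian_rank G = rank_on G (carrier G)"
  unfolding abelian_rank_def rank_on_def by (metis (no_types, lifting) int_independent_def)

context comm_group
begin

lemma lincomb_closed [simp]: "g \<in> I \<rightarrow> carrier G \<Longrightarrow> lincomb G I g c \<in> carrier G"
  unfolding lincomb_def by (rule finprod_closed) auto

lemma lincomb_add:
  assumes "g \<in> I \<rightarrow> carrier G"
  shows "lincomb G I g (\<lambda>i. c i + d i) = lincomb G I g c \<otimes> lincomb G I g d"
proof -
  have "lincomb G I g (\<lambda>i. c i + d i) = (\<Otimes>i\<in>I. g i [^] c i \<otimes> g i [^] d i)"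
    unfolding lincomb_def using assms by (intro finprod_cong') (auto simp: int_pow_mult Pi_iff)
  then show ?thesis
    unfolding lincomb_def using assms by (subst (asm) finprod_multf) auto
qed

lemma lincomb_cong:
  assumes "g \<in> I \<rightarrow> carrier G" "\<And>i. i \<in> I \<Longrightarrow> g i = g' i" "\<And>i. i \<in> I \<Longrightarrow> c i = c' i"
  shows "lincomb G I g c = lincomb G I g' c'"
  unfolding lincomb_def using assms by (intro finprod_cong') (auto simp: Pi_iff)

lemma lincomb_insert:
  assumes "finite I" "i \<notin> I" "g \<in> insert i I \<rightarrow> carrier G"
  shows "lincomb G (insert i I) g c = g i [^] c i \<otimes> lincomb G I g c"
  unfolding lincomb_def using assms by (subst finprod_insert) auto

lemma lincomb_mult:
  assumes "finite I" "g \<in> I \<rightarrow> carrier G"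
  shows "lincomb G I g c [^] (d::int) = lincomb G I g (\<lambda>i. d * c i)"
  using assms
proof (induction I rule: finite_induct)
  case empty
  then show ?case by (simp add: lincomb_def)
next
  case (insert i I)
  then have g: "g i \<in> carrier G" "g \<in> I \<rightarrow> carrier G" by auto
  with insert show ?case
    by (simp add: lincomb_insert int_pow_distrib int_pow_pow mult.commute)
qed

text \<open>Substituting combinations into a combination multiplies the coefficient matrix by the
  coefficient vector; this reduces independence of derived elements to linear algebra over the
  integers.\<close>

lemma lincomb_lincomb:
  assumes "finite I" "finite J" "g \<in> J \<rightarrow> carrier G"
  shows "lincomb G I (\<lambda>i. lincomb G J g (c i)) d = lincomb G J g (\<lambda>j. \<Sum>i\<in>I. d i * c i j)"
  using assms(1)
proof (induction I rule: finite_induct)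
  case empty
  then show ?case by (simp add: lincomb_def)
next
  case (insert i I)
  then have "lincomb G (insert i I) (\<lambda>i. lincomb G J g (c i)) d
      = lincomb G J g (c i) [^] d i \<otimes> lincomb G I (\<lambda>i. lincomb G J g (c i)) d"
    using assms by (intro lincomb_insert) auto
  also have "\<dots> = lincomb G J g (\<lambda>j. d i * c i j + (\<Sum>i\<in>I. d i * c i j))"
    using insert assms by (simp add: lincomb_mult lincomb_add)
  finally show ?case using insert by simp
qed

lemma lincomb_mono_neutral:
  assumes "finite J" "I \<subseteq> J" "g \<in> J \<rightarrow> carrier G" "\<And>i. i \<in> J - I \<Longrightarrow> c i = 0"
  shows "lincomb G I g c = lincomb G J g c"
  unfolding lincomb_def using assms
  by (intro finprod_mono_neutral_cong_left) auto

lemma lincomb_Un: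
  assumes "finite I" "finite J" "I \<inter> J = {}" "g \<in> I \<union> J \<rightarrow> carrier G"
  shows "lincomb G (I \<union> J) g c = lincomb G I g c \<otimes> lincomb G J g c"
  unfolding lincomb_def using assms
  by (intro finprod_Un_disjoint) auto

lemma lincomb_hom:
  assumes "comm_group H" "f \<in> hom G H" "g \<in> I \<rightarrow> carrier G" "finite I"
  shows "f (lincomb G I g c) = lincomb H I (\<lambda>i. f (g i)) c"
  using assms(4,3)
proof (induction I rule: finite_induct)
  case empty
  interpret H: comm_group H by fact
  interpret group_hom G H f using assms by unfold_locales auto
  show ?case by (simp add: lincomb_def)
next
  case (insert i I)
  interpret H: comm_group H by fact
  interpret group_hom G H f using assms by unfold_locales auto
  from insert have g: "g i \<in> carrier G" "g \<in> I \<rightarrow> carrier G" by auto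
  then have fg: "(\<lambda>i. f (g i)) \<in> insert i I \<rightarrow> carrier H"
    using hom_closed by (auto simp: Pi_iff)
  show ?case
    using insert g fg by (simp add: lincomb_insert H.lincomb_insert hom_int_pow)
qed

lemma independent_family_subset:
  assumes "independent_family G J g" "I \<subseteq> J"
  shows "independent_family G I g"
  unfolding independent_family_def
proof (intro conjI allI impI)
  show "finite I" "g \<in> I \<rightarrow> carrier G"
    using assms by (auto simp: independent_family_def intro: finite_subset)
next
  fix c assume c: "lincomb G I g c = \<one>"
  let ?c = "\<lambda>i. if i \<in> I then c i else 0"
  have J: "finite J" "g \<in> J \<rightarrow> carrier G" using assms by (auto simp: independent_family_def)
  have "lincomb G I g c = lincomb G I g ?c"
    using J assms by (intro lincomb_cong) auto
  also have "\<dots> = lincomb G J g ?c"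
    using J assms by (intro lincomb_mono_neutral) auto
  finally have "lincomb G J g ?c = \<one>" using c by simp
  then have "\<forall>i\<in>J. ?c i = 0"
    using assms(1) unfolding independent_family_def by blast
  then show "\<forall>i\<in>I. c i = 0"
    using assms(2) by (auto split: if_splits)
qed

lemma independent_family_inj:
  assumes "independent_family G I g"
  shows "inj_on g I"
proof (rule inj_onI, rule ccontr)
  fix i j assume ij: "i \<in> I" "j \<in> I" "g i = g j" "i \<noteq> j"
  then have ind: "independent_family G {i, j} g"
    using independent_family_subset[OF assms] by simp
  let ?c = "\<lambda>k. if k = i then 1 else - 1 :: int"
  have "lincomb G {i, j} g ?c = \<one>"
    using ij ind by (simp add: lincomb_insert lincomb_def independent_family_def int_pow_neg)
  then have "\<forall>k\<in>{i, j}. ?c k = 0"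
    using ind unfolding independent_family_def by blast
  then show False by simp
qed

lemma independent_family_image:
  assumes "independent_family G I g"
  shows "int_independent G (g ` I)" "card (g ` I) = card I"
proof -
  have inj: "inj_on g I" using assms by (rule independent_family_inj)
  then show "card (g ` I) = card I" by (rule card_image)
  have I: "finite I" "g \<in> I \<rightarrow> carrier G" using assms by (auto simp: independent_family_def)
  have "lincomb G (g ` I) (\<lambda>x. x) c = lincomb G I g (\<lambda>i. c (g i))" for c
    unfolding lincomb_def using I inj by (subst finprod_reindex) auto
  then show "int_independent G (g ` I)"
    using assms unfolding int_independent_iff_family independent_family_def by auto
qed

lemma rank_on_ge:
  assumes "independent_family G I g" "g ` I \<subseteq> A"
  shows "enat (card I) \<le> rank_on G A"
  unfolding rank_on_def using independent_family_image[OF assms(1)] assms(2)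
  by (intro Sup_upper) force

lemma one_notin_independent:
  assumes "int_independent G S"
  shows "\<one> \<notin> S"
proof
  assume "\<one> \<in> S"
  then have ind: "independent_family G {\<one>} (\<lambda>x. x)"
    using independent_family_subset assms by (metis empty_subsetI insert_subset int_independent_iff_family)
  have "lincomb G {\<one>} (\<lambda>x. x) (\<lambda>_. 1) = \<one>"
    by (simp add: lincomb_def)
  then show False using ind by (force simp: independent_family_def)
qed

lemma rank_on_one: "rank_on G {\<one>} = 0"
proof -
  have "S = {}" if "int_independent G S" "S \<subseteq> {\<one>}" for S
    using that one_notin_independent by auto
  then have "rank_on G {\<one>} \<le> 0"
    unfolding rank_on_def by (intro Sup_least) (fastforce simp: zero_enat_def)
  then show ?thesis by simp
qed

end

section \<open>Additivity of rank along a homomorphism\<close>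

lemma Sup_add_le_enat:
  fixes A B :: "enat set"
  assumes "A \<noteq> {}" "B \<noteq> {}" "\<And>a b. a \<in> A \<Longrightarrow> b \<in> B \<Longrightarrow> a + b \<le> N"
  shows "Sup A + Sup B \<le> N"
proof (cases N)
  \<comment> \<open>A finite bound makes both sets finite, so their suprema are attained and the
    hypothesis applies to them directly.\<close>
  case (enat n)
  obtain a b where ab: "a \<in> A" "b \<in> B" using assms by auto
  have "x \<le> enat n" if "x \<in> A" for x
    using assms(3)[OF that ab(2)] enat order_trans[of x "x + b"] by simp
  then have "finite A" by (rule finite_enat_bounded)
  have "x \<le> enat n" if "x \<in> B" for x
    using assms(3)[OF ab(1) that] enat order_trans[of x "a + x"] by simp
  then have "finite B" by (rule finite_enat_bounded)
  have "Sup A \<in> A" "Sup B \<in> B"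
    using assms \<open>finite A\<close> \<open>finite B\<close> by (auto simp: Sup_enat_def)
  then show ?thesis using assms by blast
qed simp

text \<open>For the upper bound, choose \<open>T \<subseteq> S\<close> maximal such that \<open>f\<close> maps \<open>T\<close> to an independent family; every
  \<open>s \<in> S - T\<close> then has a multiple which differs from a kernel element by a combination of \<open>T\<close>,
  and these kernel elements are independent.\<close>

theorem rank_nullity:
  assumes "comm_group G" "comm_group H" and f: "f \<in> hom G H"
  shows "abelian_rank G = rank_on G (kernel G H f) + rank_on H (f ` carrier G)"
proof (rule antisym)
  interpret G: comm_group G by fact
  interpret H: comm_group H by fact
  interpret group_hom G H f using f by unfold_locales auto
  show "rank_on G (kernel G H f) + rank_on H (f ` carrier G) \<le> abelian_rank G"
    unfolding rank_on_def
  proof (rule Sup_add_le_enat; (clarsimp simp: Setcompr_eq_image)?)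
    have e: "int_independent G {}" "int_independent H {}"
      by (auto simp: int_independent_def)
    show "\<exists>S. int_independent G S \<and> S \<subseteq> kernel G H f"
      "\<exists>S. int_independent H S \<and> S \<subseteq> f ` carrier G"
      using e by auto
  next
    fix S T assume S: "int_independent G S" "S \<subseteq> kernel G H f"
      and T: "int_independent H T" "T \<subseteq> f ` carrier G"
    define g where "g t = (SOME x. x \<in> carrier G \<and> f x = t)" for t
    have g: "g t \<in> carrier G" "f (g t) = t" if "t \<in> T" for t
      using that T(2) someI_ex[of "\<lambda>x. x \<in> carrier G \<and> f x = t"] unfolding g_def by auto
    have SS: "S \<subseteq> carrier G" "finite S" "finite T" using S T by (auto simp: int_independent_def)
    have inj: "inj_on g T" by (metis g(2) inj_onI)
    have fS: "f x = \<one>\<^bsub>H\<^esub>" if "x \<in> S" for x using that S(2) by (auto simp: kernel_def)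
    have disj: "S \<inter> g ` T = {}"
      using fS g(2) H.one_notin_independent[OF T(1)] by force
    have "independent_family G (S \<union> g ` T) (\<lambda>x. x)"
      unfolding independent_family_def
    proof (intro conjI allI impI)
      show "finite (S \<union> g ` T)" "(\<lambda>x. x) \<in> S \<union> g ` T \<rightarrow> carrier G"
        using SS g by auto
      fix c assume c: "lincomb G (S \<union> g ` T) (\<lambda>x. x) c = \<one>\<^bsub>G\<^esub>"
      have split: "lincomb G (S \<union> g ` T) (\<lambda>x. x) c
          = lincomb G S (\<lambda>x. x) c \<otimes>\<^bsub>G\<^esub> lincomb G (g ` T) (\<lambda>x. x) c"
        using SS g disj by (intro G.lincomb_Un) auto
      have "f (lincomb G S (\<lambda>x. x) c) = lincomb H S (\<lambda>x. \<one>\<^bsub>H\<^esub>) c"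
        using SS fS by (subst G.lincomb_hom[OF assms(2) f]) (auto intro!: H.lincomb_cong)
      then have 1: "f (lincomb G S (\<lambda>x. x) c) = \<one>\<^bsub>H\<^esub>" by (simp add: lincomb_def)
      have "f (lincomb G (g ` T) (\<lambda>x. x) c) = lincomb H (g ` T) f c"
        using SS g by (subst G.lincomb_hom[OF assms(2) f]) auto
      also have "\<dots> = lincomb H T (\<lambda>t. f (g t)) (\<lambda>t. c (g t))"
        unfolding lincomb_def using inj g T(1)
        by (subst H.finprod_reindex) (auto simp: int_independent_def)
      also have "\<dots> = lincomb H T (\<lambda>t. t) (\<lambda>t. c (g t))"
        using g T(1) by (intro H.lincomb_cong) (auto simp: int_independent_def)
      finally have 2: "f (lincomb G (g ` T) (\<lambda>x. x) c) = lincomb H T (\<lambda>t. t) (\<lambda>t. c (g t))" .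
      have cl: "lincomb G S (\<lambda>x. x) c \<in> carrier G" "lincomb G (g ` T) (\<lambda>x. x) c \<in> carrier G"
        "lincomb H T (\<lambda>t. t) (\<lambda>t. c (g t)) \<in> carrier H"
        using SS g T(1) by (auto intro!: G.lincomb_closed H.lincomb_closed simp: int_independent_def)
      have "f \<one>\<^bsub>G\<^esub> = f (lincomb G S (\<lambda>x. x) c) \<otimes>\<^bsub>H\<^esub> f (lincomb G (g ` T) (\<lambda>x. x) c)"
        unfolding c[symmetric] split using cl by simp
      then have "lincomb H T (\<lambda>t. t) (\<lambda>t. c (g t)) = \<one>\<^bsub>H\<^esub>"
        using 1 2 cl by simp
      then have cT: "\<forall>t\<in>T. c (g t) = 0"
        using T(1) unfolding int_independent_iff_family independent_family_def by blast
      then have "lincomb G (g ` T) (\<lambda>x. x) c = \<one>\<^bsub>G\<^esub>"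
        unfolding lincomb_def by (intro G.finprod_one_eqI) auto
      then have "lincomb G S (\<lambda>x. x) c = \<one>\<^bsub>G\<^esub>"
        using c split cl by simp
      then have "\<forall>x\<in>S. c x = 0"
        using S(1) unfolding int_independent_iff_family independent_family_def by blast
      then show "\<forall>i\<in>S \<union> g ` T. c i = 0" using cT by auto
    qed
    then have "enat (card (S \<union> g ` T)) \<le> abelian_rank G"
      unfolding abelian_rank_eq_rank_on by (rule G.rank_on_ge) (use SS g in auto)
    moreover have "card (S \<union> g ` T) = card S + card T"
      using disj SS inj by (simp add: card_Un_disjoint card_image)
    ultimately show "enat (card S + card T) \<le> abelian_rank G" by simp
  qed
  show "abelian_rank G \<le> rank_on G (kernel G H f) + rank_on H (f ` carrier G)"
    unfolding abelian_rank_def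
  proof (rule Sup_least, clarsimp)
    fix S assume S: "int_independent G S"
    then have SS: "S \<subseteq> carrier G" "finite S" by (auto simp: int_independent_def)
    let ?P = "\<lambda>T. T \<subseteq> S \<and> independent_family H T f"
    have "?P {}" by (simp add: independent_family_def)
    moreover have "\<forall>T. ?P T \<longrightarrow> card T < Suc (card S)"
      using SS(2) by (simp add: card_mono less_Suc_eq_le)
    ultimately obtain T where T: "?P T" and max: "\<And>T'. ?P T' \<Longrightarrow> card T' \<le> card T"
      using ex_has_greatest_nat[of ?P "{}" card] by metis
    have fT: "finite T" using T by (auto simp: independent_family_def)
    have "\<exists>c. lincomb H S f c = \<one>\<^bsub>H\<^esub> \<and> c s \<noteq> 0 \<and> (\<forall>x\<in>S - T - {s}. c x = 0)"
      if s: "s \<in> S - T" for s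
    proof -
      \<comment> \<open>By maximality of \<open>T\<close>, adding \<open>s\<close> creates a
        relation among the images; \<open>s\<close> must occur in it, since \<open>T\<close> alone
        admits none.\<close>
      have "\<not> ?P (insert s T)" using max[of "insert s T"] s fT by auto
      then have "\<not> independent_family H (insert s T) f" using T s by auto
      then obtain c where c: "lincomb H (insert s T) f c = \<one>\<^bsub>H\<^esub>"
        and nz: "\<exists>x\<in>insert s T. c x \<noteq> 0"
        proof -
        have "f \<in> insert s T \<rightarrow> carrier H" "finite (insert s T)" using SS s T fT by auto
        then show ?thesis
          using that \<open>\<not> independent_family H (insert s T) f\<close> unfolding independent_family_def by blast
      qed
      have fc: "f \<in> insert s T \<rightarrow> carrier H" "f \<in> S \<rightarrow> carrier H"
        using SS s T by auto
      have "c s \<noteq> 0"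
      proof
        assume 0: "c s = 0"
        have "lincomb H (insert s T) f c = lincomb H T f c"
          using fT fc s 0 by (simp add: H.lincomb_insert H.lincomb_closed)
        then have "\<forall>x\<in>T. c x = 0"
          using c T unfolding independent_family_def by auto
        then show False using nz 0 by auto
      qed
      moreover have "lincomb H S f (\<lambda>x. if x \<in> insert s T then c x else 0) = lincomb H (insert s T) f c"
        using SS fc s T
        by (subst H.lincomb_mono_neutral[symmetric, of S "insert s T"]) (auto intro!: H.lincomb_cong)
      ultimately show ?thesis using c
        by (intro exI[of _ "\<lambda>x. if x \<in> insert s T then c x else 0"]) auto
    qed
    then obtain c where c: "\<And>s. s \<in> S - T \<Longrightarrow>
        lincomb H S f (c s) = \<one>\<^bsub>H\<^esub> \<and> c s s \<noteq> 0 \<and> (\<forall>x\<in>S - T - {s}. c s x = 0)"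
      by metis
    \<comment> \<open>The relation attached to \<open>s\<close>, read in \<open>G\<close> instead of
      \<open>H\<close>: its image under \<open>f\<close> is trivial.\<close>
    define u where "u s = lincomb G S (\<lambda>x. x) (c s)" for s
    have idS: "(\<lambda>x. x) \<in> S \<rightarrow> carrier G" using SS by auto
    have "u s \<in> kernel G H f" if "s \<in> S - T" for s
      using c[OF that] G.lincomb_hom[OF assms(2) f idS SS(2)] G.lincomb_closed[OF idS]
      by (simp add: kernel_def u_def)
    then have "u ` (S - T) \<subseteq> kernel G H f" by blast
    moreover have "independent_family G (S - T) u"
      unfolding independent_family_def
    proof (intro conjI allI impI ballI)
      show "finite (S - T)" "u \<in> S - T \<rightarrow> carrier G"
        using SS idS by (auto simp: u_def)
      fix d s assume d: "lincomb G (S - T) u d = \<one>\<^bsub>G\<^esub>" and s: "s \<in> S - T"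
      have "lincomb G S (\<lambda>x. x) (\<lambda>j. \<Sum>i\<in>S - T. d i * c i j) = \<one>\<^bsub>G\<^esub>"
        using d SS idS G.lincomb_lincomb[of "S - T" S "\<lambda>x. x" c d] by (simp add: u_def[abs_def])
      then have "(\<Sum>i\<in>S - T. d i * c i s) = 0"
        using S s unfolding int_independent_iff_family independent_family_def by auto
      \<comment> \<open>On \<open>S - T\<close> the coefficient matrix is diagonal with nonzero
        entries, so only the summand of \<open>s\<close> survives.\<close>
      moreover have "(\<Sum>i\<in>S - T. d i * c i s) = (\<Sum>i\<in>{s}. d i * c i s)"
        using SS s c by (intro sum.mono_neutral_right) auto
      ultimately show "d s = 0" using c[OF s] by simp
    qed
    ultimately have 1: "enat (card (S - T)) \<le> rank_on G (kernel G H f)"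
      by (intro G.rank_on_ge)
    have 2: "enat (card T) \<le> rank_on H (f ` carrier G)"
      using T SS by (intro H.rank_on_ge[of T f]) auto
    have "card S = card (S - T) + card T"
      using T SS fT by (metis add.commute card_Diff_subset card_mono le_add_diff_inverse)
    then show "enat (card S) \<le> rank_on G (kernel G H f) + rank_on H (f ` carrier G)"
      using add_mono[OF 1 2] by simp
  qed
qed

section \<open>Rank of isomorphic groups, exact sequences, products and the integers\<close>

corollary abelian_rank_iso:
  assumes "comm_group G" "comm_group H" "G \<cong> H"
  shows "abelian_rank G = abelian_rank H"
proof -
  interpret G: comm_group G by fact
  obtain f where f: "f \<in> iso G H" using assms by (auto simp: is_iso_def)
  then have hom: "f \<in> hom G H" and img: "f ` carrier G = carrier H" and inj: "inj_on f (carrier G)"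
    by (auto simp: iso_def bij_betw_def)
  interpret group_hom G H f using hom assms by (simp add: group_hom_def group_hom_axioms_def comm_group_def)
  have "kernel G H f = {\<one>\<^bsub>G\<^esub>}" using inj inj_iff_trivial_ker by blast
  then show ?thesis
    using rank_nullity[OF assms(1,2) hom] img
    by (simp add: G.rank_on_one abelian_rank_eq_rank_on)
qed

corollary abelian_rank_trivial:
  assumes "comm_group G" "trivial_group G"
  shows "abelian_rank G = 0"
proof -
  interpret comm_group G by fact
  have "carrier G = {\<one>\<^bsub>G\<^esub>}" using assms(2) by (simp add: trivial_group_def)
  then show ?thesis by (simp add: abelian_rank_eq_rank_on rank_on_one)
qed

text \<open>Exactness replaces the kernel in \<open>rank_nullity\<close> by an image, so each term
  of an exact sequence has rank the sum of two image ranks, and neighbouring terms share one of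
  them.\<close>

corollary abelian_rank_exact:
  assumes "comm_group A" "comm_group B" "comm_group C" "f \<in> hom A B" "g \<in> hom B C"
    and "kernel B C g = f ` carrier A"
  shows "abelian_rank B = rank_on B (f ` carrier A) + rank_on C (g ` carrier B)"
  using rank_nullity[OF assms(2,3,5)] assms(6) by simp

text \<open>\<open>rank_nullity\<close> is used twice: for \<open>snd\<close>, and for the injection
  of \<open>G\<close>, whose image is the kernel of \<open>snd\<close>.\<close>

corollary abelian_rank_DirProd:
  assumes "comm_group G" "comm_group H"
  shows "abelian_rank (G \<times>\<times> H) = abelian_rank G + abelian_rank H"
proof -
  interpret G: comm_group G by fact
  interpret H: comm_group H by fact
  interpret GH: group "G \<times>\<times> H" by (rule DirProd_group) unfold_locales
  have GH: "comm_group (G \<times>\<times> H)"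
    by (rule GH.group_comm_groupI) (auto simp: G.m_comm H.m_comm)
  have inl: "(\<lambda>x. (x, \<one>\<^bsub>H\<^esub>)) \<in> hom G (G \<times>\<times> H)"
    and snd: "snd \<in> hom (G \<times>\<times> H) H"
    by (auto simp: hom_def)
  have ker: "kernel (G \<times>\<times> H) H snd = (\<lambda>x. (x, \<one>\<^bsub>H\<^esub>)) ` carrier G"
    by (auto simp: kernel_def)
  have im: "snd ` carrier (G \<times>\<times> H) = carrier H" by force
  have "kernel G (G \<times>\<times> H) (\<lambda>x. (x, \<one>\<^bsub>H\<^esub>)) = {\<one>\<^bsub>G\<^esub>}"
    by (auto simp: kernel_def)
  then have "abelian_rank G = rank_on (G \<times>\<times> H) (kernel (G \<times>\<times> H) H snd)"
    using rank_nullity[OF assms(1) GH inl] by (simp add: G.rank_on_one ker)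
  then show ?thesis
    using rank_nullity[OF GH assms(2) snd] by (simp only: im abelian_rank_eq_rank_on)
qed

lemma abelian_rank_integer_group: "abelian_rank integer_group = 1"
proof (rule antisym)
  interpret comm_group integer_group by (rule abelian_integer_group)
  have pow: "x [^]\<^bsub>integer_group\<^esub> (n::int) = n * x" for x n
    by (simp add: mult.commute)
  have "independent_family integer_group {1::int} (\<lambda>x. x)"
    by (auto simp: independent_family_def lincomb_def pow)
  from rank_on_ge[OF this, of UNIV] show "1 \<le> abelian_rank integer_group"
    by (simp add: abelian_rank_eq_rank_on one_enat_def)
  show "abelian_rank integer_group \<le> 1"
    unfolding abelian_rank_def
  proof (rule Sup_least)
    fix n assume "n \<in> {enat (card S) | S. int_independent integer_group S}"
    then obtain S where n: "n = enat (card S)" and S: "int_independent integer_group S" by blast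
    have "a = b" if "a \<in> S" "b \<in> S" for a b
    proof (rule ccontr)
      assume "a \<noteq> b"
      have ind: "independent_family integer_group {a, b} (\<lambda>x. x)"
        by (rule independent_family_subset[OF S[unfolded int_independent_iff_family]]) (use that in simp)
      \<comment> \<open>The relation b * a - a * b = 0; its coefficients vanish only if both
        integers are 0, hence equal.\<close>
      let ?c = "\<lambda>x. if x = a then b else - a"
      have "lincomb integer_group {a, b} (\<lambda>x. x) ?c = \<one>\<^bsub>integer_group\<^esub>"
        using \<open>a \<noteq> b\<close> by (simp add: lincomb_insert) (simp add: lincomb_def)
      then have "\<forall>x\<in>{a, b}. ?c x = 0"
        using ind unfolding independent_family_def by blast
      then show False using \<open>a \<noteq> b\<close> by simp
    qed
    then have "card S \<le> 1"
      using S card_le_Suc0_iff_eq[of S] by (simp add: int_independent_def)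
    then show "n \<le> 1" by (simp add: n one_enat_def)
  qed
qed

section \<open>Ranks of homology groups\<close>

abbreviation (input) betti :: "int \<Rightarrow> 'a topology \<Rightarrow> enat" where
  "betti p X \<equiv> abelian_rank (homology_group p X)"

lemma betti_homotopy_equivalent_space:
  assumes "X homotopy_equivalent_space Y"
  shows "betti p X = betti p Y"
  using homotopy_equivalent_space_imp_isomorphic_homology_groups[OF assms]
  by (intro abelian_rank_iso) auto

lemma betti_homeomorphic_space:
  assumes "X homeomorphic_space Y"
  shows "betti p X = betti p Y"
  using assms by (intro betti_homotopy_equivalent_space homeomorphic_imp_homotopy_equivalent_space)

lemma betti_empty: "topspace X = {} \<Longrightarrow> betti p X = 0"
  by (intro abelian_rank_trivial trivial_homology_group_empty) auto

lemma betti_0_path_connected: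
  assumes "path_connected_space X" "topspace X \<noteq> {}"
  shows "betti 0 X = 1"
  using abelian_rank_iso[OF _ _ isomorphic_integer_zeroth_homology_group[OF assms]]
  by (simp add: abelian_integer_group abelian_rank_integer_group)

lemma betti_contractible:
  assumes "contractible_space X" "topspace X \<noteq> {}"
  shows "betti 0 X = 1" "p \<noteq> 0 \<Longrightarrow> betti p X = 0"
proof -
  show "betti 0 X = 1"
    using assms by (intro betti_0_path_connected contractible_imp_path_connected_space)
  show "betti p X = 0" if "p \<noteq> 0"
    using trivial_reduced_homology_group_contractible_space[OF assms(1), of p] that
    by (intro abelian_rank_trivial) (auto simp: un_reduced_homology_group)
qed

lemma betti_disjoint_union:
  assumes "openin X S" "openin X T" "disjnt S T" "S \<union> T = topspace X"
  shows "betti p X = betti p (subtopology X S) + betti p (subtopology X T)"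
proof -
  let ?G = "homology_group p (subtopology X S)" and ?H = "homology_group p (subtopology X T)"
  have iso: "?G \<times>\<times> ?H \<cong> homology_group p X"
    using homology_additivity_explicit[OF assms] by (rule is_isoI)
  interpret group "?G \<times>\<times> ?H" by (intro DirProd_group) auto
  have GH: "comm_group (?G \<times>\<times> ?H)"
    by (rule group_comm_groupI)
      (auto simp: comm_groupE(4)[OF abelian_relative_homology_group])
  show ?thesis
    using abelian_rank_iso[OF GH _ iso] abelian_rank_DirProd[of ?G ?H] by simp
qed

lemma betti_disjoint_Union:
  assumes "finite I" "\<And>a. a \<in> I \<Longrightarrow> openin X (C a)" "disjoint_family_on C I"
    "(\<Union>a\<in>I. C a) = topspace X" "\<And>a. a \<in> I \<Longrightarrow> betti p (subtopology X (C a)) = enat n"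
  shows "betti p X = enat (card I * n)"
  using assms
proof (induction I arbitrary: X rule: finite_induct)
  case empty
  then show ?case by (simp add: betti_empty zero_enat_def)
next
  case (insert a I)
  let ?T = "\<Union>b\<in>I. C b"
  have T: "openin X ?T" using insert by blast
  have sub: "subtopology (subtopology X ?T) (C b) = subtopology X (C b)" if "b \<in> I" for b
    using that by (simp add: subtopology_subtopology) (metis UN_upper inf.absorb2)
  have IH: "betti p (subtopology X ?T) = enat (card I * n)"
  proof (rule insert.IH)
    show "openin (subtopology X ?T) (C b)" if "b \<in> I" for b
      using that insert.prems T by (auto simp: openin_open_subtopology)
    show "disjoint_family_on C I" using insert.prems(2) by (rule disjoint_family_on_mono[rotated]) auto
    show "\<Union> (C ` I) = topspace (subtopology X ?T)"
      using T by (simp add: inf.absorb2 openin_subset)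
    show "betti p (subtopology (subtopology X ?T) (C b)) = enat n" if "b \<in> I" for b
      using that insert.prems by (simp add: sub)
  qed
  have "disjnt (C a) ?T"
    using insert.prems(2) insert.hyps by (fastforce simp: disjoint_family_on_def disjnt_def)
  then have "betti p X = betti p (subtopology X (C a)) + betti p (subtopology X ?T)"
    using insert.prems T by (intro betti_disjoint_union) auto
  also have "\<dots> = enat n + enat (card I * n)"
    using insert.prems IH by simp
  finally show ?case using insert.hyps by simp
qed

section \<open>Long exact sequences and Mayer-Vietoris as equations between ranks\<close>

lemma exact_seq_hom:
  assumes "exact_seq ([C, B, A], [g, f])"
  shows "f \<in> hom A B" "g \<in> hom B C" "kernel B C g = f ` carrier A"
  using assms by (auto simp: group_hom_def group_hom_axioms_def)

lemma rank_on_image_trivial: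
  assumes "comm_group H" "trivial_group H" "f \<in> hom G H" "comm_group G"
  shows "rank_on H (f ` carrier G) = 0"
proof -
  interpret H: comm_group H by fact
  interpret G: comm_group G by fact
  have "f ` carrier G = {\<one>\<^bsub>H\<^esub>}"
    using assms G.one_closed hom_in_carrier[OF assms(3)] by (auto simp: trivial_group_def)
  then show ?thesis by (simp add: H.rank_on_one)
qed

text \<open>The numbers are the ranks of the images of the successive maps H1(S) -> H1(X) -> H1(X,S)
  -> H0(S) -> H0(X) -> H0(X,S). The term before the first map is not recorded, so \<open>a\<close>
  is only bounded.\<close>

lemma betti_long_exact_sequence:
  obtains a b c d e where
    "a \<le> betti 1 (subtopology X S)"
    "betti 1 X = a + b"
    "abelian_rank (relative_homology_group 1 X S) = b + c"
    "betti 0 (subtopology X S) = c + d"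
    "betti 0 X = d + e"
    "abelian_rank (relative_homology_group 0 X S) = e"
proof
  let ?i = "\<lambda>p. hom_induced p (subtopology X S) {} X {} id"
  let ?j = "\<lambda>p. hom_induced p X {} X S id"
  let ?d = "\<lambda>p. hom_boundary p X S"
  note ex = abelian_rank_exact[OF _ _ _ exact_seq_hom]
  show "rank_on (homology_group 1 X) (?i 1 ` carrier (homology_group 1 (subtopology X S)))
      \<le> betti 1 (subtopology X S)"
    using rank_nullity[OF _ _ hom_induced_hom[of 1 "subtopology X S" "{}" X "{}" id]] by simp
  show "betti 1 X = rank_on (homology_group 1 X) (?i 1 ` carrier (homology_group 1 (subtopology X S)))
     + rank_on (relative_homology_group 1 X S) (?j 1 ` carrier (homology_group 1 X))"
    using ex[OF _ _ _ homology_exactness_axiom_3[of 1 X S] homology_exactness_axiom_3[of 1 X S]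
        homology_exactness_axiom_3[of 1 X S]] by simp
  show "abelian_rank (relative_homology_group 1 X S)
     = rank_on (relative_homology_group 1 X S) (?j 1 ` carrier (homology_group 1 X))
     + rank_on (homology_group 0 (subtopology X S)) (?d 1 ` carrier (relative_homology_group 1 X S))"
    using ex[OF _ _ _ homology_exactness_axiom_1[of 1 X S] homology_exactness_axiom_1[of 1 X S]
        homology_exactness_axiom_1[of 1 X S]] by simp
  show "betti 0 (subtopology X S)
     = rank_on (homology_group 0 (subtopology X S)) (?d 1 ` carrier (relative_homology_group 1 X S))
     + rank_on (homology_group 0 X) (?i 0 ` carrier (homology_group 0 (subtopology X S)))"
    using ex[OF _ _ _ homology_exactness_axiom_2[of 1 X S] homology_exactness_axiom_2[of 1 X S]
        homology_exactness_axiom_2[of 1 X S]] by simp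
  show "betti 0 X
     = rank_on (homology_group 0 X) (?i 0 ` carrier (homology_group 0 (subtopology X S)))
     + rank_on (relative_homology_group 0 X S) (?j 0 ` carrier (homology_group 0 X))"
    using ex[OF _ _ _ homology_exactness_axiom_3[of 0 X S] homology_exactness_axiom_3[of 0 X S]
        homology_exactness_axiom_3[of 0 X S]] by simp
  \<comment> \<open>Homology in degree -1 is trivial, which ends the sequence with the single image
    \<open>e\<close>.\<close>
  have "rank_on (homology_group (0 - 1) (subtopology X S)) (?d 0 ` carrier (relative_homology_group 0 X S)) = 0"
    by (intro rank_on_image_trivial hom_boundary_hom) auto
  then show "abelian_rank (relative_homology_group 0 X S)
     = rank_on (relative_homology_group 0 X S) (?j 0 ` carrier (homology_group 0 X))"
    using ex[OF _ _ _ homology_exactness_axiom_1[of 0 X S] homology_exactness_axiom_1[of 0 X S]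
        homology_exactness_axiom_1[of 0 X S]] by simp
qed

text \<open>The sequences of the pairs (X, V) and (U, U \<inter> V) have relative terms of equal
  rank by excision; comparing them eliminates these terms.\<close>

theorem betti_Mayer_Vietoris:
  assumes "openin X U" "openin X V" "U \<union> V = topspace X"
    and U: "betti 1 (subtopology X U) = 0"
    and V: "betti 1 (subtopology X V) = 0"
  shows "betti 1 X + betti 0 (subtopology X U) + betti 0 (subtopology X V)
    = betti 0 (subtopology X (U \<inter> V)) + betti 0 X"
proof -
  have exc: "abelian_rank (relative_homology_group p (subtopology X U) (U \<inter> V))
      = abelian_rank (relative_homology_group p X V)" for p
  proof -
    \<comment> \<open>The excised set: it is closed, and it lies in the open set \<open>V\<close>
      because \<open>U\<close> and \<open>V\<close> cover.\<close>
    let ?W = "topspace X - U"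
    have "closedin X ?W" using assms(1) by blast
    then have "X closure_of ?W \<subseteq> X interior_of V"
      using assms(2,3) by (auto simp: closure_of_closedin interior_of_openin)
    moreover have "V \<subseteq> topspace X" "U \<subseteq> topspace X" using assms openin_subset by auto
    ultimately have "hom_induced p (subtopology X (topspace X - ?W)) (V - ?W) (subtopology X (topspace X)) V id
        \<in> iso (relative_homology_group p (subtopology X (topspace X - ?W)) (V - ?W))
            (relative_homology_group p (subtopology X (topspace X)) V)"
      by (intro homology_excision_axiom) auto
    moreover have "topspace X - ?W = U" "V - ?W = U \<inter> V"
      using \<open>V \<subseteq> topspace X\<close> \<open>U \<subseteq> topspace X\<close> by auto
    ultimately show ?thesis
      by (intro abelian_rank_iso) (auto intro: is_isoI)
  qed
  obtain a b c d e where X: "a \<le> betti 1 (subtopology X V)" "betti 1 X = a + b"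
    "abelian_rank (relative_homology_group 1 X V) = b + c"
    "betti 0 (subtopology X V) = c + d" "betti 0 X = d + e"
    "abelian_rank (relative_homology_group 0 X V) = e"
    using betti_long_exact_sequence[of X V] .
  have sub: "subtopology (subtopology X U) (U \<inter> V) = subtopology X (U \<inter> V)"
    by (simp add: subtopology_subtopology)
  obtain a' b' c' d' e' where U': "betti 1 (subtopology X U) = a' + b'"
    "abelian_rank (relative_homology_group 1 X V) = b' + c'"
    "betti 0 (subtopology X (U \<inter> V)) = c' + d'" "betti 0 (subtopology X U) = d' + e'"
    "abelian_rank (relative_homology_group 0 X V) = e'"
    by (rule betti_long_exact_sequence[of "subtopology X U" "U \<inter> V", unfolded exc sub])
      (rule that, assumption+)
  \<comment> \<open>Vanishing of the first Betti numbers of \<open>V\<close> and \<open>U\<close>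
    removes exactly the image ranks that the remaining groups do not determine.\<close>
  have "a = 0" "b' = 0" using X(1) U'(1) U V by auto
  then have "c' = b + c" "e' = e" using X U' by auto
  then show ?thesis
    using X U' \<open>a = 0\<close> by (simp add: ac_simps)
qed

section \<open>The star in coordinates\<close>

text \<open>At \<open>s = 0\<close> the arm index is forgotten, so the arms are glued at the centre
  without a quotient.\<close>

definition spike :: "nat \<Rightarrow> real \<Rightarrow> nat \<Rightarrow> real" where
  "spike i s = (\<lambda>j. if j = i then s else 0)"

definition star_model :: "nat \<Rightarrow> (nat \<Rightarrow> real) \<Rightarrow> (nat \<Rightarrow> real) set" where
  "star_model k w = {spike i s | i s. i \<in> {1..k} \<and> 0 \<le> s \<and> s \<le> w i}"

definition l1_dist :: "nat \<Rightarrow> (nat \<Rightarrow> real) \<Rightarrow> (nat \<Rightarrow> real) \<Rightarrow> real" where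
  "l1_dist k x y = (\<Sum>i = 1..k. \<bar>x i - y i\<bar>)"

definition star_config :: "nat \<Rightarrow> (nat \<Rightarrow> real) \<Rightarrow> real \<Rightarrow> ((nat \<Rightarrow> real) \<times> (nat \<Rightarrow> real)) set" where
  "star_config k w r = {(x, y). x \<in> star_model k w \<and> y \<in> star_model k w \<and> r \<le> l1_dist k x y}"

text \<open>The centre gets arm 0, outside \<open>{1..k}\<close>; this is harmless because its
  height is 0.\<close>

definition star_coords :: "(nat \<Rightarrow> real) \<Rightarrow> (nat, nat) gpoint \<Rightarrow> nat \<Rightarrow> real" where
  "star_coords w p = spike (star_arm p) (star_height w p)"

lemma spike_zero [simp]: "spike i 0 = (\<lambda>_. 0)"
  by (auto simp: spike_def)

lemma l1_dist_spike:
  assumes "i \<in> {1..k}" "j \<in> {1..k}" "0 \<le> s" "0 \<le> t"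
  shows "l1_dist k (spike i s) (spike j t) = (if i = j then \<bar>s - t\<bar> else s + t)"
proof -
  have "l1_dist k (spike i s) (spike j t) = (\<Sum>l\<in>{i, j}. \<bar>spike i s l - spike j t l\<bar>)"
    unfolding l1_dist_def using assms
    by (intro sum.mono_neutral_right) (auto simp: spike_def)
  then show ?thesis using assms by (auto simp: spike_def)
qed

lemma sum_spike:
  assumes "i \<in> {1..k}"
  shows "sum (spike i s) {Suc 0..k} = s"
  using assms by (simp add: spike_def)

lemma star_coords_edge_point:
  assumes "\<And>i. 0 < w i" "1 \<le> i" "0 \<le> t" "t \<le> w i"
  shows "star_coords w (edge_point (star_graph k w) i t) = spike i t"
  using assms by (auto simp: star_coords_def edge_point_star)

lemma l1_dist_star_coords:
  assumes w: "\<And>i. 0 < w i" and k: "1 \<le> k"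
    and "p \<in> graph_points (star_graph k w)" "q \<in> graph_points (star_graph k w)"
  shows "l1_dist k (star_coords w p) (star_coords w q) = path_dist (star_graph k w) p q"
proof -
  obtain i s where p: "1 \<le> i" "i \<le> k" "0 \<le> s" "s \<le> w i" "p = edge_point (star_graph k w) i s"
    using star_point_cases[OF assms(3) k w] by metis
  obtain j t where q: "1 \<le> j" "j \<le> k" "0 \<le> t" "t \<le> w j" "q = edge_point (star_graph k w) j t"
    using star_point_cases[OF assms(4) k w] by metis
  show ?thesis
    unfolding path_dist_star[OF assms] using p q w
    by (simp add: star_coords_edge_point l1_dist_spike star_dist_edge)
qed

lemma bij_betw_star_coords:
  assumes w: "\<And>i. 0 < w i" and k: "1 \<le> k"
  shows "bij_betw (star_coords w) (graph_points (star_graph k w)) (star_model k w)"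
proof -
  interpret M: Metric_space "graph_points (star_graph k w)" "path_dist (star_graph k w)"
    using w k by (rule Metric_space_star)
  show ?thesis
    unfolding bij_betw_def
  proof (intro conjI subset_antisym)
    \<comment> \<open>Injectivity comes from the isometry: points with equal images are at distance
      0.\<close>
    show "inj_on (star_coords w) (graph_points (star_graph k w))"
    proof (rule inj_onI)
      fix p q assume *: "p \<in> graph_points (star_graph k w)" "q \<in> graph_points (star_graph k w)"
        "star_coords w p = star_coords w q"
      then have "path_dist (star_graph k w) p q = 0"
        using l1_dist_star_coords[OF w k *(1,2)] by (simp add: l1_dist_def)
      then show "p = q" using * by simp
    qed
    show "star_coords w ` graph_points (star_graph k w) \<subseteq> star_model k w"
    proof clarify
      fix p assume p: "p \<in> graph_points (star_graph k w)"
      obtain i s where "1 \<le> i" "i \<le> k" "0 \<le> s" "s \<le> w i" "p = edge_point (star_graph k w) i s"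
        using star_point_cases[OF p k w] by metis
      then show "star_coords w p \<in> star_model k w"
        using w by (auto simp: star_coords_edge_point star_model_def)
    qed
    show "star_model k w \<subseteq> star_coords w ` graph_points (star_graph k w)"
    proof
      fix x assume "x \<in> star_model k w"
      then obtain i s where "i \<in> {1..k}" "0 \<le> s" "s \<le> w i" "x = spike i s"
        by (auto simp: star_model_def)
      then show "x \<in> star_coords w ` graph_points (star_graph k w)"
        using w edge_point_star_in_points[of i k w s]
        by (intro image_eqI[of _ _ "edge_point (star_graph k w) i s"]) (auto simp: star_coords_edge_point)
    qed
  qed
qed

lemma l1_dist_continuous [continuous_intros]:
  assumes "continuous_on S f" "continuous_on S g"
  shows "continuous_on S (\<lambda>z. l1_dist k (f z) (g z))"
  unfolding l1_dist_def
  using continuous_on_product_then_coordinatewise[OF assms(1)]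
    continuous_on_product_then_coordinatewise[OF assms(2)]
  by (intro continuous_on_sum continuous_on_rabs continuous_on_diff)

text \<open>The target carries the product topology. Each coordinate is 1-Lipschitz for the path
  metric, which gives one direction; conversely the \<open>l1\<close> distance is a finite sum of
  continuous functions, so its balls are open in the product topology.\<close>

lemma homeomorphic_map_star_coords:
  assumes w: "\<And>i. 0 < w i" and k: "1 \<le> k"
  shows "homeomorphic_map (graph_topology (star_graph k w)) (top_of_set (star_model k w)) (star_coords w)"
proof -
  let ?P = "graph_points (star_graph k w)"
  interpret M: Metric_space ?P "path_dist (star_graph k w)"
    using w k by (rule Metric_space_star)
  let ?g = "inv_into ?P (star_coords w)"
  have bij: "bij_betw (star_coords w) ?P (star_model k w)"
    using w k by (rule bij_betw_star_coords)
  have d: "l1_dist k (star_coords w p) (star_coords w q) = path_dist (star_graph k w) p q"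
    if "p \<in> ?P" "q \<in> ?P" for p q
    using l1_dist_star_coords[OF w k that] .
  have lip: "\<bar>star_coords w p i - star_coords w q i\<bar> \<le> path_dist (star_graph k w) p q"
    if "p \<in> ?P" "q \<in> ?P" for p q i
  proof (cases "i \<in> {1..k}")
    case True
    then show ?thesis unfolding d[OF that, symmetric] l1_dist_def
      by (intro member_le_sum[of i _ "\<lambda>i. \<bar>star_coords w p i - star_coords w q i\<bar>"]) auto
  next
    case False
    have "star_coords w p i = 0" if "p \<in> ?P" for p
      using bij_betw_apply[OF bij that] False by (auto simp: star_model_def spike_def)
    then show ?thesis using that by simp
  qed
  have "continuous_map M.mtopology euclideanreal (\<lambda>p. star_coords w p i)" for i
  proof -
    have "continuous_map M.mtopology Met_TC.mtopology (\<lambda>p. star_coords w p i)"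
      unfolding Met_TC.continuous_map_to_metric
    proof (intro ballI allI impI)
      fix p and \<epsilon> :: real assume p: "p \<in> topspace M.mtopology" "0 < \<epsilon>"
      show "\<exists>U. openin M.mtopology U \<and> p \<in> U \<and>
          (\<forall>q\<in>U. star_coords w q i \<in> Met_TC.mball (star_coords w p i) \<epsilon>)"
      proof (intro exI conjI ballI)
        show "openin M.mtopology (M.mball p \<epsilon>)" "p \<in> M.mball p \<epsilon>" using p by auto
        fix q assume "q \<in> M.mball p \<epsilon>"
        then show "star_coords w q i \<in> Met_TC.mball (star_coords w p i) \<epsilon>"
          using lip[of p q i] by (auto simp: dist_real_def)
      qed
    qed
    then show ?thesis by simp
  qed
  then have "continuous_map M.mtopology (product_topology (\<lambda>i. euclideanreal) UNIV) (star_coords w)"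
    by (simp add: continuous_map_componentwise_UNIV)
  then have f: "continuous_map M.mtopology (top_of_set (star_model k w)) (star_coords w)"
    using bij by (auto simp: euclidean_product_topology continuous_map_in_subtopology bij_betw_def)
  have gf: "?g (star_coords w p) = p" if "p \<in> ?P" for p
    using bij that by (simp add: bij_betw_def)
  have fg: "star_coords w (?g x) = x" "?g x \<in> ?P" if "x \<in> star_model k w" for x
    using bij that by (auto simp: bij_betw_def f_inv_into_f inv_into_into)
  have g: "continuous_map (top_of_set (star_model k w)) M.mtopology ?g"
    unfolding M.continuous_map_to_metric
  proof (intro ballI allI impI)
    fix x and \<epsilon> :: real assume x: "x \<in> topspace (top_of_set (star_model k w))" "0 < \<epsilon>"
    let ?U = "{y \<in> star_model k w. l1_dist k x y \<in> {..<\<epsilon>}}"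
    show "\<exists>U. openin (top_of_set (star_model k w)) U \<and> x \<in> U \<and> (\<forall>y\<in>U. ?g y \<in> M.mball (?g x) \<epsilon>)"
    proof (intro exI conjI ballI)
      show "openin (top_of_set (star_model k w)) ?U"
        using continuous_openin_preimage_gen[of "star_model k w" "l1_dist k x" "{..<\<epsilon>}"]
        by (simp add: vimage_def Int_def conj_commute continuous_intros)
      show "x \<in> ?U" using x by (simp add: l1_dist_def)
      fix y assume "y \<in> ?U"
      then show "?g y \<in> M.mball (?g x) \<epsilon>"
        using x fg d[of "?g x" "?g y"] by auto
    qed
  qed
  have "homeomorphic_maps M.mtopology (top_of_set (star_model k w)) (star_coords w) ?g"
    unfolding homeomorphic_maps_def using f g gf fg by auto
  then show ?thesis
    unfolding graph_topology_def homeomorphic_map_maps by blast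
qed

lemma config_space2_star_homeomorphic:
  assumes w: "\<And>i. 0 < w i" and k: "1 \<le> k"
  shows "config_space2 (star_graph k w) r homeomorphic_space top_of_set (star_config k w r)"
proof -
  let ?P = "graph_points (star_graph k w)" and ?X = "graph_topology (star_graph k w)"
  let ?Y = "top_of_set (star_model k w)"
  let ?C = "{(x, y). x \<in> ?P \<and> y \<in> ?P \<and> r \<le> path_dist (star_graph k w) x y}"
  interpret M: Metric_space ?P "path_dist (star_graph k w)"
    using w k by (rule Metric_space_star)
  have bij: "bij_betw (star_coords w) ?P (star_model k w)"
    using w k by (rule bij_betw_star_coords)
  obtain g where "homeomorphic_maps ?X ?Y (star_coords w) g"
    using homeomorphic_map_star_coords[of w k, OF w k] unfolding homeomorphic_map_maps by blast
  then have "homeomorphic_maps (prod_topology ?X ?X) (prod_topology ?Y ?Y)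
      (\<lambda>(x, y). (star_coords w x, star_coords w y)) (\<lambda>(x, y). (g x, g y))"
    unfolding homeomorphic_maps_prod by blast
  then have h: "homeomorphic_map (prod_topology ?X ?X) (prod_topology ?Y ?Y)
      (\<lambda>(x, y). (star_coords w x, star_coords w y))"
    unfolding homeomorphic_map_maps by blast
  have 1: "homeomorphic_map (subtopology (prod_topology ?X ?X) ?C)
      (subtopology (prod_topology ?Y ?Y) (star_config k w r)) (\<lambda>(x, y). (star_coords w x, star_coords w y))"
  proof (rule homeomorphic_map_subtopologies_alt[OF h])
    fix z assume "z \<in> topspace (prod_topology ?X ?X)"
    then obtain p q where "z = (p, q)" "p \<in> ?P" "q \<in> ?P"
      by (auto simp: graph_topology_def)
    then show "(case z of (x, y) \<Rightarrow> (star_coords w x, star_coords w y)) \<in> star_config k w r \<longleftrightarrow> z \<in> ?C"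
      using bij_betw_apply[OF bij] by (auto simp: star_config_def l1_dist_star_coords[of w k, OF w k])
  qed
  have 2: "subtopology (prod_topology ?Y ?Y) (star_config k w r) = top_of_set (star_config k w r)"
    by (auto simp: subtopology_subtopology star_config_def intro!: arg_cong[of _ _ "subtopology euclidean"])
  show ?thesis
    using homeomorphic_map_imp_homeomorphic_space[OF 1] unfolding config_space2_def 2 .
qed

section \<open>Star-shaped pieces\<close>

type_synonym config = "(nat \<Rightarrow> real) \<times> (nat \<Rightarrow> real)"

text \<open>The straight-line homotopy from \<open>z\<close> to \<open>p\<close>, formed in the
  ambient coordinate space; the star itself is not convex, hence the need for suitable base
  points.\<close>

definition slide :: "real \<Rightarrow> config \<Rightarrow> config \<Rightarrow> config" where
  "slide u z p = ((\<lambda>i. (1 - u) * fst z i + u * fst p i), (\<lambda>i. (1 - u) * snd z i + u * snd p i))"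

definition star_shaped :: "config set \<Rightarrow> config \<Rightarrow> bool" where
  "star_shaped W p \<longleftrightarrow> p \<in> W \<and> (\<forall>z\<in>W. \<forall>u\<in>{0..1}. slide u z p \<in> W)"

lemma continuous_on_fst_apply: "continuous_on S (\<lambda>z. fst (f z) i)"
  and continuous_on_snd_apply: "continuous_on S (\<lambda>z. snd (f z) i)"
  if "continuous_on S f" for f :: "'a::topological_space \<Rightarrow> config"
  using that
  by (auto intro!: continuous_on_product_then_coordinatewise[of S "\<lambda>z. fst (f z)"]
      continuous_on_product_then_coordinatewise[of S "\<lambda>z. snd (f z)"] continuous_on_fst continuous_on_snd)

lemma star_shaped_contractible:
  assumes "star_shaped W p"
  shows "contractible_space (top_of_set W)"
proof -
  have "continuous_on ({0..1} \<times> W) (\<lambda>(u, z). slide u z p)"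
    unfolding slide_def case_prod_unfold
    by (intro continuous_on_Pair continuous_on_coordinatewise_then_product continuous_intros
        continuous_on_fst_apply continuous_on_snd_apply)
  then have "homotopic_with (\<lambda>_. True) (top_of_set W) (top_of_set W) id (\<lambda>_. p)"
    unfolding homotopic_with_def
    using assms by (intro exI[of _ "\<lambda>(u, z). slide u z p"]) (auto simp: star_shaped_def slide_def)
  then show ?thesis unfolding contractible_space_def by blast
qed

text \<open>The open sets \<open>N a\<close> make each piece open in \<open>Z\<close> and in the
  union. This serves both additivity of homology and the openness hypotheses of Mayer-Vietoris.
  Star-shaped sets are nonempty, so every index counts once.\<close>

lemma betti_star_shaped_pieces:
  assumes "finite I" "\<And>a. a \<in> I \<Longrightarrow> open (N a)" "\<And>a. a \<in> I \<Longrightarrow> C a = Z \<inter> N a"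
    and "disjoint_family_on C I" "\<And>a. a \<in> I \<Longrightarrow> star_shaped (C a) (p a)"
  shows "openin (top_of_set Z) (\<Union>a\<in>I. C a)"
    "betti 0 (top_of_set (\<Union>a\<in>I. C a)) = enat (card I)"
    "betti 1 (top_of_set (\<Union>a\<in>I. C a)) = 0"
proof -
  let ?W = "\<Union>a\<in>I. C a"
  show "openin (top_of_set Z) ?W"
    using assms(2,3) by (intro openin_Union) (auto simp: openin_open_Int)
  have op: "openin (top_of_set ?W) (C a)" if "a \<in> I" for a
  proof -
    have "C a = ?W \<inter> N a" using assms(3) that by auto
    then show ?thesis using assms(2)[OF that] by (metis openin_open_Int)
  qed
  have sub: "subtopology (top_of_set ?W) (C a) = top_of_set (C a)" if "a \<in> I" for a
    using that by (simp add: subtopology_subtopology) (metis UN_upper inf.absorb2)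
  have ne: "C a \<noteq> {}" if "a \<in> I" for a using assms(5)[OF that] by (auto simp: star_shaped_def)
  have "betti 0 (top_of_set ?W) = enat (card I * 1)"
    using assms(1,4) op
  proof (intro betti_disjoint_Union)
    show "betti 0 (subtopology (top_of_set ?W) (C a)) = enat 1" if "a \<in> I" for a
      using betti_contractible(1)[OF star_shaped_contractible[OF assms(5)[OF that]]] ne that
      by (simp add: sub one_enat_def)
  qed auto
  then show "betti 0 (top_of_set ?W) = enat (card I)" by simp
  have "betti 1 (top_of_set ?W) = enat (card I * 0)"
    using assms(1,4) op
  proof (intro betti_disjoint_Union)
    show "betti 1 (subtopology (top_of_set ?W) (C a)) = enat 0" if "a \<in> I" for a
      using betti_contractible(2)[OF star_shaped_contractible[OF assms(5)[OF that]], of 1] ne that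
      by (simp add: sub zero_enat_def)
  qed auto
  then show "betti 1 (top_of_set ?W) = 0" by (simp add: zero_enat_def)
qed

lemma star_shaped_swap:
  assumes "star_shaped W p"
  shows "star_shaped (prod.swap ` W) (prod.swap p)"
proof -
  have "slide u (prod.swap z) (prod.swap p) = prod.swap (slide u z p)" for u z
    by (simp add: slide_def)
  then show ?thesis using assms by (auto simp: star_shaped_def)
qed

text \<open>If the base point lies on the same arms, the segment stays in the star and only the two
  heights move; star-shapedness thus reduces to inequalities between real numbers.\<close>

lemma slide_spike:
  "slide u (spike i s, spike j t) (spike i s', spike j t')
    = (spike i ((1 - u) * s + u * s'), spike j ((1 - u) * t + u * t'))"
  by (auto simp: slide_def spike_def)

lemma mix_ge: "c \<le> (1 - u) * a + u * b" if "0 \<le> u" "u \<le> 1" "c \<le> a" "c \<le> b" for a b c u :: real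
  using convex_bound_le[of "- a" "- c" "- b" "1 - u" u] that by simp

lemma mix_gt: "c < (1 - u) * a + u * b" if "0 \<le> u" "u \<le> 1" "c < a" "c < b" for a b c u :: real
  using convex_bound_lt[of "- a" "- c" "- b" "1 - u" u] that by simp

lemma mix_le: "(1 - u) * a + u * b \<le> c" if "0 \<le> u" "u \<le> 1" "a \<le> c" "b \<le> c" for a b c u :: real
  using convex_bound_le[of a c b "1 - u" u] that by simp

text \<open>The distance of two points is a sum or a difference of heights; these identities show it
  as a convex combination of its end values along a slide.\<close>

lemma mix_add: "((1 - u) * a + u * b) + ((1 - u) * c + u * d) = (1 - u) * (a + c) + u * (b + d)"
  and mix_diff: "((1 - u) * a + u * b) - ((1 - u) * c + u * d) = (1 - u) * (a - c) + u * (b - d)"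
  for a b c d u :: real
  by (simp_all add: algebra_simps)

lemma spike_same [simp]: "spike i s i = s"
  and spike_other [simp]: "j \<noteq> i \<Longrightarrow> spike i s j = 0"
  by (simp_all add: spike_def)

section \<open>The cover of the configuration space by arms and cells\<close>

locale star_configuration =
  fixes k :: nat and w :: "nat \<Rightarrow> real" and r :: real
  assumes w_pos: "\<And>i. 0 < w i" and r_pos: "0 < r"
begin

abbreviation Z :: "config set" where "Z \<equiv> star_config k w r"

text \<open>In \<open>arm (b, i)\<close> the flag \<open>b\<close> tells whether the first or the second point is the higher one.
  The sum of the coordinates of a point of the star is its height.\<close>

definition cell :: "nat \<times> nat \<Rightarrow> config set" where
  "cell = (\<lambda>(i, j). Z \<inter> {z. 0 < fst z i \<and> 0 < snd z j})"

text \<open>The inequality selects the nonempty cells: the pair of leaves is the farthest pair on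
  two given arms.\<close>

definition cell_index :: "(nat \<times> nat) set" where
  "cell_index = {(i, j). i \<in> {1..k} \<and> j \<in> {1..k} \<and> i \<noteq> j \<and> r \<le> w i + w j}"

definition long_arms :: "nat set" where
  "long_arms = {i \<in> {1..k}. r \<le> w i}"

definition arm :: "bool \<times> nat \<Rightarrow> config set" where
  "arm = (\<lambda>(b, i). Z \<inter> (if b then {z. (\<Sum>l = 1..k. snd z l) < fst z i}
    else {z. (\<Sum>l = 1..k. fst z l) < snd z i}))"

text \<open>In \<open>(b, i, j)\<close> the higher point is on arm \<open>i\<close> and the lower
  one on arm \<open>j\<close>; cells list the arm of the first point first, hence the reordering by
  \<open>b\<close>.\<close>

definition overlap :: "bool \<times> nat \<times> nat \<Rightarrow> config set" where
  "overlap = (\<lambda>(b, i, j). arm (b, i) \<inter> cell (if b then (i, j) else (j, i)))"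

lemma Z_cases:
  assumes "z \<in> Z"
  obtains i j s t where "i \<in> {1..k}" "j \<in> {1..k}" "0 \<le> s" "s \<le> w i" "0 \<le> t" "t \<le> w j"
    "z = (spike i s, spike j t)" "r \<le> (if i = j then \<bar>s - t\<bar> else s + t)"
proof -
  obtain i j s t where *: "i \<in> {1..k}" "j \<in> {1..k}" "0 \<le> s" "s \<le> w i" "0 \<le> t" "t \<le> w j"
    "z = (spike i s, spike j t)" "r \<le> l1_dist k (spike i s) (spike j t)"
    using assms by (auto simp: star_config_def star_model_def)
  then show ?thesis using l1_dist_spike[of i k j s t] by (intro that[of i j s t]) simp_all
qed

lemma spike_pair_in_Z:
  assumes "i \<in> {1..k}" "j \<in> {1..k}" "0 \<le> s" "s \<le> w i" "0 \<le> t" "t \<le> w j"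
  shows "(spike i s, spike j t) \<in> Z \<longleftrightarrow> r \<le> (if i = j then \<bar>s - t\<bar> else s + t)"
  using assms l1_dist_spike[of i k j s t] unfolding star_config_def star_model_def by auto

lemma swap_Z: "prod.swap z \<in> Z \<longleftrightarrow> z \<in> Z"
  by (cases z) (auto simp: star_config_def l1_dist_def abs_minus_commute)

lemma cell_cases:
  assumes "z \<in> cell (i, j)" "i \<noteq> j"
  obtains s t where "z = (spike i s, spike j t)" "i \<in> {1..k}" "j \<in> {1..k}" "0 < s" "s \<le> w i" "0 < t" "t \<le> w j" "r \<le> s + t"
proof -
  have z: "z \<in> Z" "0 < fst z i" "0 < snd z j" using assms(1) by (auto simp: cell_def)
  obtain i' j' s t where *: "i' \<in> {1..k}" "j' \<in> {1..k}" "0 \<le> s" "s \<le> w i'" "0 \<le> t" "t \<le> w j'"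
    "z = (spike i' s, spike j' t)" "r \<le> (if i' = j' then \<bar>s - t\<bar> else s + t)"
    using Z_cases[OF z(1)] .
  then have "i' = i" "j' = j" using z by (auto simp: spike_def split: if_splits)
  with * z assms(2) show ?thesis by (intro that[of s t]) auto
qed

lemma cellI:
  assumes "i \<in> {1..k}" "j \<in> {1..k}" "i \<noteq> j" "0 < s" "s \<le> w i" "0 < t" "t \<le> w j" "r \<le> s + t"
  shows "(spike i s, spike j t) \<in> cell (i, j)"
  using assms spike_pair_in_Z[of i j s t] by (auto simp: cell_def)

lemma arm_cases:
  assumes "z \<in> arm (True, i)"
  obtains j s t where "z = (spike i s, spike j t)" "i \<in> {1..k}" "j \<in> {1..k}" "s \<le> w i" "0 \<le> t" "t \<le> w j"
    "t < s" "r \<le> (if i = j then s - t else s + t)"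
proof -
  have z: "z \<in> Z" "(\<Sum>l = 1..k. snd z l) < fst z i" using assms(1) by (auto simp: arm_def)
  obtain i' j s t where *: "i' \<in> {1..k}" "j \<in> {1..k}" "0 \<le> s" "s \<le> w i'" "0 \<le> t" "t \<le> w j"
    "z = (spike i' s, spike j t)" "r \<le> (if i' = j then \<bar>s - t\<bar> else s + t)"
    using Z_cases[OF z(1)] .
  have t: "t < spike i' s i" using z(2) *(2,7) by (simp add: sum_spike)
  then have "i' = i" using *(5) by (auto simp: spike_def split: if_splits)
  with * t show ?thesis by (intro that[of s j t]) auto
qed

lemma armI:
  assumes "i \<in> {1..k}" "j \<in> {1..k}" "s \<le> w i" "0 \<le> t" "t \<le> w j" "t < s"
    "r \<le> (if i = j then s - t else s + t)"
  shows "(spike i s, spike j t) \<in> arm (True, i)"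
  using assms spike_pair_in_Z[of i j s t] sum_spike[of j k t] by (auto simp: arm_def)

text \<open>Exchanging the two points preserves \<open>Z\<close>, so only the case of a higher first
  point needs geometry.\<close>

lemma arm_False: "arm (False, i) = prod.swap ` arm (True, i)"
proof -
  have "z \<in> arm (False, i) \<longleftrightarrow> prod.swap z \<in> arm (True, i)" for z
    by (auto simp: arm_def swap_Z)
  then show ?thesis by (force simp: image_iff)
qed

lemma cell_swap: "cell (j, i) = prod.swap ` cell (i, j)"
proof -
  have "z \<in> cell (j, i) \<longleftrightarrow> prod.swap z \<in> cell (i, j)" for z
    by (auto simp: cell_def swap_Z)
  then show ?thesis by (force simp: image_iff)
qed

lemma overlap_False: "overlap (False, i, j) = prod.swap ` overlap (True, i, j)"
  by (simp add: overlap_def arm_False cell_swap[of j i] image_Int)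

lemma star_shaped_cell:
  assumes "(i, j) \<in> cell_index"
  shows "star_shaped (cell (i, j)) (spike i (w i), spike j (w j))"
  unfolding star_shaped_def
proof (intro conjI ballI)
  have ij: "i \<in> {1..k}" "j \<in> {1..k}" "i \<noteq> j" "r \<le> w i + w j"
    using assms by (auto simp: cell_index_def)
  then show "(spike i (w i), spike j (w j)) \<in> cell (i, j)" using w_pos by (intro cellI) auto
  fix z and u :: real assume z: "z \<in> cell (i, j)" and u: "u \<in> {0..1}"
  obtain s t where *: "z = (spike i s, spike j t)" "0 < s" "s \<le> w i" "0 < t" "t \<le> w j" "r \<le> s + t"
    using cell_cases[OF z ij(3)] by metis
  show "slide u z (spike i (w i), spike j (w j)) \<in> cell (i, j)"
    unfolding *(1) slide_spike using * ij u w_pos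
    by (intro cellI) (auto intro!: mix_gt mix_le mix_ge simp: mix_add)
qed

text \<open>The higher point moves to its leaf, the other to the centre. On a common arm the
  distance is \<open>s - t\<close>, otherwise \<open>s + t\<close>; either is affine along the slide
  and ends at \<open>w i\<close>, which is at least \<open>r\<close> as the arm is long.\<close>

lemma star_shaped_arm_True:
  assumes "i \<in> long_arms"
  shows "star_shaped (arm (True, i)) (spike i (w i), (\<lambda>_. 0))"
  unfolding star_shaped_def
proof (intro conjI ballI)
  have i: "i \<in> {1..k}" "r \<le> w i" using assms by (auto simp: long_arms_def)
  show "(spike i (w i), \<lambda>_. 0) \<in> arm (True, i)"
    using armI[of i i "w i" 0] i w_pos[of i] by simp
  fix z and u :: real assume z: "z \<in> arm (True, i)" and u: "u \<in> {0..1}"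
  obtain j s t where *: "z = (spike i s, spike j t)" "j \<in> {1..k}" "s \<le> w i" "0 \<le> t" "t \<le> w j"
    "t < s" "r \<le> (if i = j then s - t else s + t)"
    using arm_cases[OF z] by metis
  \<comment> \<open>The centre is read as \<open>spike j 0\<close>, so one base point serves every
    arm \<open>j\<close> of the lower point; \<open>u * 0\<close> is kept to match the shape of the
    \<open>mix\<close> lemmas.\<close>
  have "(spike i ((1 - u) * s + u * w i), spike j ((1 - u) * t + u * 0)) \<in> arm (True, i)"
  proof (rule armI)
    have "0 < ((1 - u) * s + u * w i) - ((1 - u) * t + u * 0)"
      unfolding mix_diff using * u w_pos[of i] by (intro mix_gt) auto
    then show "(1 - u) * t + u * 0 < (1 - u) * s + u * w i" by simp
    show "r \<le> (if i = j then (1 - u) * s + u * w i - ((1 - u) * t + u * 0)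
        else (1 - u) * s + u * w i + ((1 - u) * t + u * 0))"
      unfolding mix_diff mix_add using * u i by (auto intro!: mix_ge)
    show "(1 - u) * s + u * w i \<le> w i" "0 \<le> (1 - u) * t + u * 0" "(1 - u) * t + u * 0 \<le> w j"
      using * u w_pos[of j] mix_le[where a = t and b = 0 and c = "w j" and u = u] by (auto intro!: mix_le)
  qed (use * i in auto)
  then show "slide u z (spike i (w i), \<lambda>_. 0) \<in> arm (True, i)"
    using slide_spike[of u i s j t "w i" 0] *(1) by simp
qed

lemma star_shaped_overlap_True:
  assumes "i \<in> long_arms" "j \<in> {1..k}" "i \<noteq> j"
  shows "star_shaped (overlap (True, i, j)) (spike i (w i), spike j (min (w i) (w j) / 2))"
  unfolding star_shaped_def
proof (intro conjI ballI)
  have i: "i \<in> {1..k}" "r \<le> w i" using assms by (auto simp: long_arms_def)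
  \<comment> \<open>A height that is positive (for the cell), below \<open>w i\<close> (for the arm)
    and available on arm \<open>j\<close>.\<close>
  let ?m = "min (w i) (w j) / 2"
  have m: "0 < ?m" "?m < w i" "?m \<le> w j" using w_pos[of i] w_pos[of j] by (auto simp: min_def)
  show "(spike i (w i), spike j ?m) \<in> overlap (True, i, j)"
    using armI[of i j "w i" ?m] cellI[of i j "w i" ?m] i assms m w_pos[of i] by (simp add: overlap_def)
  fix z and u :: real assume z: "z \<in> overlap (True, i, j)" and u: "u \<in> {0..1}"
  have zc: "z \<in> cell (i, j)" using z by (simp add: overlap_def)
  obtain s t where *: "z = (spike i s, spike j t)" "0 < s" "s \<le> w i" "0 < t" "t \<le> w j" "r \<le> s + t"
    using cell_cases[OF zc assms(3)] by metis
  have "t < s" using z i(1) assms(2) *(1) by (simp add: overlap_def arm_def sum_spike)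
  define s' t' where st: "s' = (1 - u) * s + u * w i" "t' = (1 - u) * t + u * ?m"
  have "0 < s' - t'"
    unfolding st mix_diff using * u m \<open>t < s\<close> by (intro mix_gt) auto
  moreover have "r \<le> s' + t'"
    unfolding st mix_add using * u i m by (intro mix_ge) auto
  moreover have "0 < s'" "s' \<le> w i" "0 < t'" "t' \<le> w j"
    unfolding st by (intro mix_gt mix_le; use * u w_pos[of i] m in simp)+
  ultimately have "(spike i s', spike j t') \<in> overlap (True, i, j)"
    using armI[of i j s' t'] cellI[of i j s' t'] i assms by (simp add: overlap_def)
  then show "slide u z (spike i (w i), spike j ?m) \<in> overlap (True, i, j)"
    unfolding *(1) slide_spike st .
qed

lemma Z_coordinates:
  assumes "z \<in> Z"
  shows "fst z i \<le> (\<Sum>l = 1..k. fst z l)" "snd z i \<le> (\<Sum>l = 1..k. snd z l)" "0 \<le> fst z i" "0 \<le> snd z i"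
    and "0 < fst z i \<Longrightarrow> 0 < fst z j \<Longrightarrow> i = j" "0 < snd z i \<Longrightarrow> 0 < snd z j \<Longrightarrow> i = j"
proof -
  obtain a b s t where *: "a \<in> {1..k}" "b \<in> {1..k}" "0 \<le> s" "0 \<le> t" "z = (spike a s, spike b t)"
    using Z_cases[OF assms] by metis
  show "fst z i \<le> (\<Sum>l = 1..k. fst z l)" "snd z i \<le> (\<Sum>l = 1..k. snd z l)" "0 \<le> fst z i" "0 \<le> snd z i"
    using * by (simp_all add: sum_spike) (simp_all add: spike_def)
  show "0 < fst z i \<Longrightarrow> 0 < fst z j \<Longrightarrow> i = j" "0 < snd z i \<Longrightarrow> 0 < snd z j \<Longrightarrow> i = j"
    using * by (auto simp: spike_def split: if_splits)
qed

lemma arm_subset: "arm a \<subseteq> Z" and cell_subset: "cell c \<subseteq> Z"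
  by (auto simp: arm_def cell_def split: prod.splits)

lemma arm_pos:
  assumes "z \<in> arm (b, i)"
  shows "0 < (if b then fst z i else snd z i)"
proof -
  have "z \<in> Z" using assms arm_subset by blast
  then have "0 \<le> (\<Sum>l = 1..k. fst z l)" "0 \<le> (\<Sum>l = 1..k. snd z l)"
    by (auto intro!: sum_nonneg Z_coordinates)
  then show ?thesis using assms by (auto simp: arm_def split: if_splits)
qed

text \<open>The strict inequalities without the constraint \<open>Z\<close>, hence open in the
  ambient space.\<close>

definition arm_nbhd :: "bool \<times> nat \<Rightarrow> config set" where
  "arm_nbhd = (\<lambda>(b, i). if b then {z. (\<Sum>l = 1..k. snd z l) < fst z i}
    else {z. (\<Sum>l = 1..k. fst z l) < snd z i})"

definition cell_nbhd :: "nat \<times> nat \<Rightarrow> config set" where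
  "cell_nbhd = (\<lambda>(i, j). {z. 0 < fst z i \<and> 0 < snd z j})"

lemma continuous_coordinates:
  "continuous_on S (\<lambda>z::config. fst z i)" "continuous_on S (\<lambda>z::config. snd z i)"
  by (rule continuous_on_fst_apply continuous_on_snd_apply, rule continuous_on_id)+

lemma open_arm_nbhd: "open (arm_nbhd a)"
  by (cases a)
    (auto simp: arm_nbhd_def intro!: open_Collect_less continuous_on_sum continuous_coordinates)

lemma open_cell_nbhd: "open (cell_nbhd a)"
  by (cases a)
    (auto simp: cell_nbhd_def intro!: open_Collect_conj open_Collect_less continuous_on_const continuous_coordinates)

lemma arm_eq: "arm a = Z \<inter> arm_nbhd a"
  by (cases a) (simp add: arm_def arm_nbhd_def)

lemma cell_eq: "cell a = Z \<inter> cell_nbhd a"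
  by (cases a) (simp add: cell_def cell_nbhd_def)

definition arm_index :: "(bool \<times> nat) set" where
  "arm_index = UNIV \<times> long_arms"

text \<open>Only the arm of the higher point must be long: \<open>r \<le> w i\<close> already makes
  every cell on \<open>i\<close> and another arm nonempty.\<close>

definition overlap_index :: "(bool \<times> nat \<times> nat) set" where
  "overlap_index = UNIV \<times> (SIGMA i:long_arms. {1..k} - {i})"

definition arm_base :: "bool \<times> nat \<Rightarrow> config" where
  "arm_base = (\<lambda>(b, i). if b then (spike i (w i), \<lambda>_. 0) else (\<lambda>_. 0, spike i (w i)))"

definition cell_base :: "nat \<times> nat \<Rightarrow> config" where
  "cell_base = (\<lambda>(i, j). (spike i (w i), spike j (w j)))"

definition overlap_base :: "bool \<times> nat \<times> nat \<Rightarrow> config" where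
  "overlap_base = (\<lambda>(b, i, j). (if b then id else prod.swap) (spike i (w i), spike j (min (w i) (w j) / 2)))"

lemma finite_index [simp]: "finite arm_index" "finite cell_index" "finite overlap_index" "finite long_arms"
proof -
  show "finite long_arms" by (simp add: long_arms_def)
  then show "finite arm_index" "finite overlap_index" by (auto simp: arm_index_def overlap_index_def)
  show "finite cell_index"
    by (rule finite_subset[of _ "{1..k} \<times> {1..k}"]) (auto simp: cell_index_def)
qed

lemma star_shaped_cell': "a \<in> cell_index \<Longrightarrow> star_shaped (cell a) (cell_base a)"
  using star_shaped_cell by (cases a) (simp add: cell_base_def)

lemma star_shaped_arm: "a \<in> arm_index \<Longrightarrow> star_shaped (arm a) (arm_base a)"
proof (cases a)
  case (Pair b i)
  assume "a \<in> arm_index"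
  then have "star_shaped (arm (True, i)) (spike i (w i), \<lambda>_. 0)"
    using Pair by (intro star_shaped_arm_True) (simp add: arm_index_def)
  then show ?thesis
    using star_shaped_swap[of "arm (True, i)" "(spike i (w i), \<lambda>_. 0)"] Pair
    by (cases b) (simp_all add: arm_base_def arm_False)
qed

lemma star_shaped_overlap: "a \<in> overlap_index \<Longrightarrow> star_shaped (overlap a) (overlap_base a)"
proof (cases a)
  case (fields b i j)
  let ?p = "(spike i (w i), spike j (min (w i) (w j) / 2))"
  assume "a \<in> overlap_index"
  then have "star_shaped (overlap (True, i, j)) ?p"
    using fields by (intro star_shaped_overlap_True) (auto simp: overlap_index_def)
  then show ?thesis
    using star_shaped_swap[of "overlap (True, i, j)" ?p] fields
    by (cases b) (simp_all add: overlap_base_def overlap_False)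
qed

lemma disjoint_cells: "disjoint_family_on cell I"
  unfolding disjoint_family_on_def
proof (intro ballI impI, rule ccontr)
  fix a b assume "a \<noteq> b" and "cell a \<inter> cell b \<noteq> {}"
  then obtain z where z: "z \<in> cell a" "z \<in> cell b" by blast
  obtain i j i' j' where ab: "a = (i, j)" "b = (i', j')" by (cases a, cases b)
  have "i = i'" "j = j'"
    using z ab Z_coordinates(5)[of z i i'] Z_coordinates(6)[of z j j'] by (auto simp: cell_def)
  then show False using ab \<open>a \<noteq> b\<close> by simp
qed

lemma disjoint_arms: "disjoint_family_on arm I"
  unfolding disjoint_family_on_def
proof (intro ballI impI, rule ccontr)
  fix a b assume "a \<noteq> b" and "arm a \<inter> arm b \<noteq> {}"
  then obtain z where z: "z \<in> arm a" "z \<in> arm b" by blast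
  obtain c i c' i' where ab: "a = (c, i)" "b = (c', i')" by (cases a, cases b)
  have Z: "z \<in> Z" using z arm_subset by blast
  \<comment> \<open>A coordinate is at most the height of its point, and the two points cannot each
    be strictly higher than the other.\<close>
  have "c = c'"
    using z ab Z_coordinates(1)[OF Z, of i] Z_coordinates(2)[OF Z, of i]
      Z_coordinates(1)[OF Z, of i'] Z_coordinates(2)[OF Z, of i']
    by (auto simp: arm_def split: if_splits)
  moreover have "i = i'"
    using arm_pos[of z c i] arm_pos[of z c' i'] z ab \<open>c = c'\<close>
      Z_coordinates(5)[OF Z, of i i'] Z_coordinates(6)[OF Z, of i i'] by (auto split: if_splits)
  ultimately show False using ab \<open>a \<noteq> b\<close> by simp
qed

lemma disjoint_overlaps: "disjoint_family_on overlap I"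
  unfolding disjoint_family_on_def
proof (intro ballI impI, rule ccontr)
  fix a b assume "a \<noteq> b" and "overlap a \<inter> overlap b \<noteq> {}"
  then obtain z where z: "z \<in> overlap a" "z \<in> overlap b" by blast
  obtain c i j c' i' j' where ab: "a = (c, i, j)" "b = (c', i', j')" by (cases a, cases b)
  have "(c, i) = (c', i')"
    using z ab disjoint_family_onD[OF disjoint_arms UNIV_I UNIV_I, of "(c, i)" "(c', i')"]
    by (auto simp only: overlap_def)
  moreover have "(if c then (i, j) else (j, i)) = (if c' then (i', j') else (j', i'))"
  proof (rule ccontr)
    have "z \<in> cell (if c then (i, j) else (j, i)) \<inter> cell (if c' then (i', j') else (j', i'))"
      using z ab by (simp add: overlap_def)
    moreover assume "\<not> ?thesis"
    ultimately show False using disjoint_family_onD[OF disjoint_cells UNIV_I UNIV_I] by blast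
  qed
  ultimately show False using ab \<open>a \<noteq> b\<close> by (auto split: if_splits)
qed

lemma Z_cover: "(\<Union>a\<in>arm_index. arm a) \<union> (\<Union>a\<in>cell_index. cell a) = Z"
proof (intro subset_antisym subsetI)
  fix z assume "z \<in> Z"
  then obtain i j s t where *: "i \<in> {1..k}" "j \<in> {1..k}" "0 \<le> s" "s \<le> w i" "0 \<le> t" "t \<le> w j"
    "z = (spike i s, spike j t)" "r \<le> (if i = j then \<bar>s - t\<bar> else s + t)"
    by (rule Z_cases)
  \<comment> \<open>Outside the cells the points share an arm or one is at the centre. The distance
    is then the difference of heights, so the higher point has height at least \<open>r\<close> and
    its arm is long.\<close>
  consider "i \<noteq> j" "0 < s" "0 < t" | "r \<le> s" "t < s" "i = j \<or> t = 0" | "r \<le> t" "s < t" "i = j \<or> s = 0"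
    using * r_pos by (cases "s = 0"; cases "t = 0") (auto simp: abs_if split: if_splits)
  then show "z \<in> (\<Union>a\<in>arm_index. arm a) \<union> (\<Union>a\<in>cell_index. cell a)"
  proof cases
    case 1
    then have "z \<in> cell (i, j)" "(i, j) \<in> cell_index"
      using * cellI[of i j s t] by (auto simp: cell_index_def)
    then show ?thesis by blast
  next
    case 2
    then have "z \<in> arm (True, i)" "(True, i) \<in> arm_index"
      using * armI[of i j s t] by (auto simp: arm_index_def long_arms_def abs_if split: if_splits)
    then show ?thesis by blast
  next
    case 3
    then have "prod.swap z \<in> arm (True, j)" "(False, j) \<in> arm_index"
      using * armI[of j i t s] by (auto simp: arm_index_def long_arms_def abs_if split: if_splits)
    then have "z \<in> arm (False, j)" unfolding arm_False by (metis image_eqI swap_swap)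
    then show ?thesis using \<open>(False, j) \<in> arm_index\<close> by blast
  qed
qed (use arm_subset cell_subset in blast)

lemma overlap_Union:
  "(\<Union>a\<in>arm_index. arm a) \<inter> (\<Union>a\<in>cell_index. cell a) = (\<Union>a\<in>overlap_index. overlap a)"
proof (intro subset_antisym subsetI)
  fix z assume "z \<in> (\<Union>a\<in>arm_index. arm a) \<inter> (\<Union>a\<in>cell_index. cell a)"
  then obtain b l i j where *: "(b, l) \<in> arm_index" "z \<in> arm (b, l)" "(i, j) \<in> cell_index" "z \<in> cell (i, j)"
    by (metis Int_iff UN_E surj_pair)
  have Z: "z \<in> Z" using * arm_subset by blast
  \<comment> \<open>Arm and cell each name a positive coordinate of the higher point, and it has
    only one.\<close>
  have "l = (if b then i else j)"
    using arm_pos[OF *(2)] *(4) Z_coordinates(5)[OF Z, of l i] Z_coordinates(6)[OF Z, of l j]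
    by (auto simp: cell_def split: if_splits)
  then have "z \<in> overlap (b, l, if b then j else i)" "(b, l, if b then j else i) \<in> overlap_index"
    using * by (auto simp: overlap_def overlap_index_def arm_index_def cell_index_def)
  then show "z \<in> (\<Union>a\<in>overlap_index. overlap a)" by blast
next
  fix z assume "z \<in> (\<Union>a\<in>overlap_index. overlap a)"
  then obtain b i j where *: "(b, i, j) \<in> overlap_index" "z \<in> overlap (b, i, j)"
    by (metis UN_E surj_pair)
  then have "(b, i) \<in> arm_index" "(if b then (i, j) else (j, i)) \<in> cell_index"
    using less_imp_le[OF w_pos[of j]]
    by (auto simp: overlap_index_def arm_index_def cell_index_def long_arms_def)
  then show "z \<in> (\<Union>a\<in>arm_index. arm a) \<inter> (\<Union>a\<in>cell_index. cell a)"
    using *(2) by (force simp: overlap_def)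
qed

lemma card_indices:
  "card arm_index = 2 * card long_arms" "card overlap_index = 2 * (card long_arms * (k - 1))"
proof -
  show "card arm_index = 2 * card long_arms"
    by (simp add: arm_index_def card_cartesian_product)
  have "card (SIGMA i:long_arms. {1..k} - {i}) = (\<Sum>i\<in>long_arms. k - 1)"
    by (subst card_SigmaI) (auto simp: long_arms_def intro!: sum.cong)
  then show "card overlap_index = 2 * (card long_arms * (k - 1))"
    by (simp add: overlap_index_def card_cartesian_product)
qed

text \<open>Arms and cells are the vertices, overlaps the edges of a bipartite graph, and the
  equation is b1 + vertices = edges + b0.\<close>

theorem betti_1_formula:
  "betti 1 (top_of_set Z) + enat (2 * card long_arms) + enat (card cell_index)
    = enat (2 * (card long_arms * (k - 1))) + betti 0 (top_of_set Z)"
proof -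
  let ?U = "\<Union>a\<in>arm_index. arm a" and ?V = "\<Union>a\<in>cell_index. cell a"
  note U = betti_star_shaped_pieces[OF finite_index(1) open_arm_nbhd arm_eq disjoint_arms star_shaped_arm]
  note V = betti_star_shaped_pieces[OF finite_index(2) open_cell_nbhd cell_eq disjoint_cells star_shaped_cell']
  have eq: "overlap (b, i, j) = Z \<inter> (arm_nbhd (b, i) \<inter> cell_nbhd (if b then (i, j) else (j, i)))" for b i j
    by (auto simp: overlap_def arm_eq cell_eq)
  have "betti 0 (top_of_set (\<Union>a\<in>overlap_index. overlap a)) = enat (card overlap_index)"
    by (rule betti_star_shaped_pieces(2)[OF finite_index(3) _ _ disjoint_overlaps star_shaped_overlap,
        where Z = Z and N = "\<lambda>(b, i, j). arm_nbhd (b, i) \<inter> cell_nbhd (if b then (i, j) else (j, i))"])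
      (auto simp: eq open_arm_nbhd open_cell_nbhd)
  moreover have "subtopology (top_of_set Z) W = top_of_set W" if "W \<subseteq> Z" for W
    using that by (simp add: subtopology_subtopology inf.absorb2)
  moreover have "?U \<subseteq> Z" "?V \<subseteq> Z" "?U \<inter> ?V \<subseteq> Z" using Z_cover by auto
  ultimately show ?thesis
    using betti_Mayer_Vietoris[OF U(1) V(1)] Z_cover U(2,3) V(2,3)
    by (simp add: overlap_Union card_indices)
qed

end

section \<open>Path connectivity when at least three arms are long\<close>

lemma star_shaped_path_component:
  assumes "star_shaped W p" "x \<in> W" "y \<in> W" "W \<subseteq> S"
  shows "path_component S x y"
proof -
  have "path_connected_space (top_of_set W)"
    using assms(1) by (intro contractible_imp_path_connected_space star_shaped_contractible)
  then have "path_connected W" by simp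
  then have "path_component W x y"
    using assms(2,3) path_connected_component by blast
  then show ?thesis using assms(4) path_component_of_subset by blast
qed

context star_configuration
begin

lemma arm_cell_connected:
  assumes "(b, i, j) \<in> overlap_index"
  shows "path_component Z (arm_base (b, i)) (cell_base (if b then (i, j) else (j, i)))"
proof -
  let ?c = "if b then (i, j) else (j, i)"
  have idx: "(b, i) \<in> arm_index" "?c \<in> cell_index"
    using assms less_imp_le[OF w_pos[of j]]
    by (auto simp: overlap_index_def arm_index_def cell_index_def long_arms_def)
  have "overlap_base (b, i, j) \<in> overlap (b, i, j)"
    using star_shaped_overlap[OF assms] by (simp add: star_shaped_def)
  then have m: "overlap_base (b, i, j) \<in> arm (b, i)" "overlap_base (b, i, j) \<in> cell ?c"
    by (simp_all add: overlap_def)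
  have "path_component Z (arm_base (b, i)) (overlap_base (b, i, j))"
    using star_shaped_arm[OF idx(1)] m(1) arm_subset
    by (intro star_shaped_path_component[of "arm (b, i)"]) (auto simp: star_shaped_def)
  moreover have "path_component Z (overlap_base (b, i, j)) (cell_base ?c)"
    using star_shaped_cell'[OF idx(2)] m(2) cell_subset
    by (intro star_shaped_path_component[of "cell ?c"]) (auto simp: star_shaped_def)
  ultimately show ?thesis by (rule path_component_trans)
qed

text \<open>Both neighbourhoods meet the cell \<open>(i, j)\<close>: either point may be the higher
  one there.\<close>

lemma opposite_arms_connected:
  assumes "i \<in> long_arms" "j \<in> long_arms" "i \<noteq> j"
  shows "path_component Z (arm_base (True, i)) (arm_base (False, j))"
proof -
  have "path_component Z (arm_base (True, i)) (cell_base (i, j))"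
    using arm_cell_connected[of True i j] assms by (auto simp: overlap_index_def long_arms_def)
  moreover have "path_component Z (arm_base (False, j)) (cell_base (i, j))"
    using arm_cell_connected[of False j i] assms by (auto simp: overlap_index_def long_arms_def)
  ultimately show ?thesis by (metis path_component_sym path_component_trans)
qed

text \<open>Two neighbourhoods with the same flag are joined through one of the opposite flag on a
  third long arm. The second hypothesis ties every cell to some arm, so no cell is left
  isolated.\<close>

lemma path_connected_Z:
  assumes "3 \<le> card long_arms" and "\<And>i j. (i, j) \<in> cell_index \<Longrightarrow> i \<in> long_arms \<or> j \<in> long_arms"
  shows "path_connected Z" "Z \<noteq> {}"
proof -
  have "\<exists>j\<in>long_arms. j \<noteq> a \<and> j \<noteq> b" for a b
  proof (rule ccontr)
    assume "\<not> ?thesis"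
    then have "long_arms \<subseteq> {a, b}" by blast
    then have "card long_arms \<le> card {a, b}" by (intro card_mono) auto
    also have "\<dots> \<le> 2" by (simp add: card_insert_if)
    finally show False using assms(1) by simp
  qed
  then have ex: "\<And>a b. \<exists>j\<in>long_arms. j \<noteq> a \<and> j \<noteq> b" .
  obtain o' where o': "o' \<in> long_arms" using ex by blast
  let ?o = "arm_base (True, o')"
  have True: "path_component Z (arm_base (True, i)) ?o" if "i \<in> long_arms" for i
  proof -
    obtain j where "j \<in> long_arms" "j \<noteq> i" "j \<noteq> o'" using ex by blast
    then show ?thesis
      using opposite_arms_connected[of i j] opposite_arms_connected[of o' j] that o'
      by (metis path_component_sym path_component_trans)
  qed
  have False: "path_component Z (arm_base (False, i)) ?o" if "i \<in> long_arms" for i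
  proof -
    obtain j where "j \<in> long_arms" "j \<noteq> i" using ex by blast
    then show ?thesis
      using opposite_arms_connected[of j i] True[of j] that
      by (metis path_component_sym path_component_trans)
  qed
  have arm: "path_component Z (arm_base a) ?o" if "a \<in> arm_index" for a
    using that True False by (cases a; cases "fst a") (auto simp: arm_index_def)
  have cell: "path_component Z (cell_base c) ?o" if c: "c \<in> cell_index" for c
  proof -
    obtain i j where ij: "c = (i, j)" by (cases c)
    then have in_range: "i \<in> {1..k}" "j \<in> {1..k}" "i \<noteq> j" using c by (auto simp: cell_index_def)
    from assms(2) c ij consider "i \<in> long_arms" | "j \<in> long_arms" by blast
    then show ?thesis
    proof cases
      case 1
      then have "path_component Z (arm_base (True, i)) (cell_base c)"
        using arm_cell_connected[of True i j] in_range ij by (auto simp: overlap_index_def)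
      then show ?thesis using True[OF 1] by (metis path_component_sym path_component_trans)
    next
      case 2
      then have "path_component Z (arm_base (False, j)) (cell_base c)"
        using arm_cell_connected[of False j i] in_range ij by (auto simp: overlap_index_def)
      then show ?thesis using False[OF 2] by (metis path_component_sym path_component_trans)
    qed
  qed
  have all: "path_component Z z ?o" if "z \<in> Z" for z
  proof -
    from that Z_cover consider a where "a \<in> arm_index" "z \<in> arm a" | c where "c \<in> cell_index" "z \<in> cell c"
      by blast
    then show ?thesis
    proof cases
      case 1
      have "path_component Z z (arm_base a)"
        using star_shaped_arm[OF 1(1)] 1(2) arm_subset
        by (intro star_shaped_path_component[of "arm a"]) (auto simp: star_shaped_def)
      then show ?thesis using arm[OF 1(1)] by (rule path_component_trans)
    next
      case 2
      have "path_component Z z (cell_base c)"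
        using star_shaped_cell'[OF 2(1)] 2(2) cell_subset
        by (intro star_shaped_path_component[of "cell c"]) (auto simp: star_shaped_def)
      then show ?thesis using cell[OF 2(1)] by (rule path_component_trans)
    qed
  qed
  then show "path_connected Z"
    unfolding path_connected_component by (metis path_component_sym path_component_trans)
  have "?o \<in> arm (True, o')"
    using star_shaped_arm[of "(True, o')"] o' by (simp add: arm_index_def star_shaped_def)
  then show "Z \<noteq> {}" using arm_subset by blast
qed

lemma betti_connected:
  assumes "3 \<le> card long_arms" and "\<And>i j. (i, j) \<in> cell_index \<Longrightarrow> i \<in> long_arms \<or> j \<in> long_arms"
  shows "betti 0 (top_of_set Z) = 1"
    "betti 1 (top_of_set Z)
      = enat (2 * (card long_arms * (k - 1)) + 1 - (2 * card long_arms + card cell_index))"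
proof -
  have "path_connected_space (top_of_set Z)"
    using path_connected_Z(1)[OF assms] by simp
  then show 0: "betti 0 (top_of_set Z) = 1"
    using path_connected_Z(2)[OF assms] by (intro betti_0_path_connected) auto
  show "betti 1 (top_of_set Z)
      = enat (2 * (card long_arms * (k - 1)) + 1 - (2 * card long_arms + card cell_index))"
    \<comment> \<open>The right-hand side of the formula is finite, so \<open>betti 1\<close> is
      too, and the truncated subtraction is exact.\<close>
    using betti_1_formula unfolding 0 by (cases "betti 1 (top_of_set Z)") (auto simp: one_enat_def)
qed

section \<open>Disjoint decompositions when at most one arm is long\<close>

lemma betti_no_long_arms:
  assumes "long_arms = {}"
  shows "betti 0 (top_of_set Z) = enat (card cell_index)" "betti 1 (top_of_set Z) = 0"
proof -
  have "(\<Union>a\<in>cell_index. cell a) = Z" using Z_cover assms by (simp add: arm_index_def)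
  then show "betti 0 (top_of_set Z) = enat (card cell_index)" "betti 1 (top_of_set Z) = 0"
    using betti_star_shaped_pieces(2,3)[OF finite_index(2) open_cell_nbhd cell_eq disjoint_cells star_shaped_cell']
    by simp_all
qed

text \<open>Comparing only coordinate 1, not the heights, merges \<open>arm (True, 1)\<close> with
  all cells whose first point is on arm 1 into one set, and symmetrically for
  \<open>False\<close>.\<close>

definition far :: "bool \<Rightarrow> config set" where
  "far b = Z \<inter> (if b then {z. snd z 1 < fst z 1} else {z. fst z 1 < snd z 1})"

text \<open>The slide is that of \<open>arm (True, 1)\<close>. On another arm the second point may
  be the higher one, so the order of heights is preserved only when both points are on arm
  1.\<close>

lemma star_shaped_far_True:
  assumes "1 \<in> long_arms"
  shows "star_shaped (far True) (arm_base (True, 1))"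
  unfolding star_shaped_def
proof (intro conjI ballI)
  have 1: "1 \<in> {1..k}" "r \<le> w 1" using assms by (auto simp: long_arms_def)
  show "arm_base (True, 1) \<in> far True"
    using spike_pair_in_Z[of 1 1 "w 1" 0] 1 w_pos[of 1] by (simp add: far_def arm_base_def)
  fix z and u :: real assume z: "z \<in> far True" and u: "u \<in> {0..1}"
  then have Z: "z \<in> Z" and gt: "snd z 1 < fst z 1" by (auto simp: far_def)
  obtain i j s t where *: "i \<in> {1..k}" "j \<in> {1..k}" "0 \<le> s" "s \<le> w i" "0 \<le> t" "t \<le> w j"
    "z = (spike i s, spike j t)" "r \<le> (if i = j then \<bar>s - t\<bar> else s + t)"
    using Z_cases[OF Z] .
  have i: "i = 1" using gt * by (auto simp: spike_def split: if_splits)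
  have st: "0 < s" "j = 1 \<Longrightarrow> t < s" using gt * i by (auto simp: spike_def split: if_splits)
  define s' t' where s': "s' = (1 - u) * s + u * w 1" "t' = (1 - u) * t + u * 0"
  have "0 < s'" "0 \<le> t'" "s' \<le> w 1"
    using st(1) * u w_pos[of 1] i unfolding s' by (auto intro!: mix_gt mix_le)
  moreover have "t' \<le> w j"
    using * u w_pos[of j] unfolding s' by (intro mix_le) auto
  moreover have "t' < s'" if "j = 1"
  proof -
    have "0 < s' - t'" using st that u w_pos[of 1] unfolding s' mix_diff by (intro mix_gt) auto
    then show ?thesis by simp
  qed
  moreover have "r \<le> (if 1 = j then \<bar>s' - t'\<bar> else s' + t')"
  proof (cases "j = 1")
    case True
    then have "r \<le> s - t" using * st(2) i by simp
    then have "r \<le> s' - t'" using u 1 unfolding s' mix_diff by (intro mix_ge) auto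
    then show ?thesis using True by simp
  next
    case False
    then have "r \<le> s' + t'" using * u 1 i unfolding s' mix_add by (intro mix_ge) auto
    then show ?thesis using False by simp
  qed
  ultimately have "(spike 1 s', spike j t') \<in> far True"
    using spike_pair_in_Z[of 1 j s' t'] 1 *(2) by (auto simp: far_def spike_def)
  then show "slide u z (arm_base (True, 1)) \<in> far True"
    using slide_spike[of u 1 s j t "w 1" 0] *(7) i unfolding s' by (simp add: arm_base_def)
qed

lemma far_False: "far False = prod.swap ` far True"
proof -
  have "z \<in> far False \<longleftrightarrow> prod.swap z \<in> far True" for z
    by (auto simp: far_def swap_Z)
  then show ?thesis by (force simp: image_iff)
qed

lemma betti_one_long_arm:
  assumes "long_arms = {1}"
  shows "betti 0 (top_of_set Z) = enat (2 + card {(i, j) \<in> cell_index. i \<noteq> 1 \<and> j \<noteq> 1})"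
    "betti 1 (top_of_set Z) = 0"
proof -
  let ?J = "{(i, j) \<in> cell_index. i \<noteq> 1 \<and> j \<noteq> 1}"
  \<comment> \<open>Two far pieces, one per flag, and the cells avoiding arm 1.\<close>
  let ?I = "(UNIV :: bool set) <+> ?J"
  let ?C = "case_sum far cell"
  let ?N = "case_sum (\<lambda>b. if b then {z. snd z 1 < fst z 1} else {z. fst z 1 < snd z 1}) cell_nbhd"
  let ?p = "case_sum (\<lambda>b. arm_base (b, 1)) cell_base"
  have fin: "finite ?J" by (rule finite_subset[OF _ finite_index(2)]) auto
  have far: "star_shaped (far b) (arm_base (b, 1))" for b
    using star_shaped_far_True star_shaped_swap[OF star_shaped_far_True] assms
    by (cases b) (simp_all add: far_False arm_base_def)
  have far_cell: "far b \<inter> cell c = {}" if c: "c \<in> ?J" for b c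
  proof -
    obtain i j where ij: "c = (i, j)" "i \<noteq> 1" "j \<noteq> 1" using c by (cases c) auto
    have "fst z 1 = 0 \<and> snd z 1 = 0" if "z \<in> cell c" for z
    proof -
      have "z \<in> Z" "0 < fst z i" "0 < snd z j" using that ij by (auto simp: cell_def)
      then show ?thesis
        using Z_coordinates(3,4)[of z 1] Z_coordinates(5)[of z 1 i] Z_coordinates(6)[of z 1 j] ij by force
    qed
    then have "z \<notin> far b" if "z \<in> cell c" for z using that by (simp add: far_def)
    then show ?thesis by blast
  qed
  have far_far: "far b \<inter> far b' = {}" if "b \<noteq> b'" for b b'
    using that by (cases b; cases b') (auto simp: far_def)
  have disj: "disjoint_family_on ?C ?I"
    unfolding disjoint_family_on_def
  proof (intro ballI impI)
    fix a b assume ab: "a \<in> ?I" "b \<in> ?I" "a \<noteq> b"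
    then show "?C a \<inter> ?C b = {}"
      using far_far far_cell disjoint_family_onD[OF disjoint_cells UNIV_I UNIV_I]
      by (cases a; cases b) (auto simp: Int_commute)
  qed
  have ope: "open (?N a)" for a
    by (cases a) (auto simp: open_cell_nbhd intro!: open_Collect_less continuous_coordinates)
  have eq: "?C a = Z \<inter> ?N a" for a
    by (cases a) (simp_all add: far_def cell_eq)
  have star: "star_shaped (?C a) (?p a)" if "a \<in> ?I" for a
    using that far star_shaped_cell' by (cases a) auto
  have "(\<Union>a\<in>?I. ?C a) = Z"
  proof (intro subset_antisym subsetI)
    fix z assume Z: "z \<in> Z"
    show "z \<in> (\<Union>a\<in>?I. ?C a)"
    proof (cases "fst z 1 = snd z 1")
      case False
      then have "z \<in> far (snd z 1 < fst z 1)" using Z by (simp add: far_def)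
      then show ?thesis by (intro UN_I[of "Inl (snd z 1 < fst z 1)"]) auto
    next
      case True
      obtain i j s t where *: "i \<in> {1..k}" "j \<in> {1..k}" "0 \<le> s" "s \<le> w i" "0 \<le> t" "t \<le> w j"
        "z = (spike i s, spike j t)" "r \<le> (if i = j then \<bar>s - t\<bar> else s + t)"
        using Z_cases[OF Z] .
      \<comment> \<open>A short arm can neither hold a point at distance \<open>r\<close> from the
        centre nor both points; this excludes every configuration with equal first coordinates
        except those in cells off arm 1.\<close>
      have short: "w l < r" if "l \<in> {1..k}" "l \<noteq> 1" for l
        using assms that by (force simp: long_arms_def)
      have i: "i \<noteq> 1"
      proof
        assume "i = 1"
        then have "j \<noteq> 1" "s = 0" using True * r_pos by (auto simp: spike_def split: if_splits)
        then show False using short[of j] * \<open>i = 1\<close> by auto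
      qed
      have j: "j \<noteq> 1"
      proof
        assume "j = 1"
        then have "t = 0" using True * i by (auto simp: spike_def split: if_splits)
        then show False using short[of i] * \<open>j = 1\<close> i by auto
      qed
      have "i \<noteq> j" using short[of i] i * by (auto simp: abs_if split: if_splits)
      moreover have "0 < s" "0 < t" using short[of i] short[of j] i j * \<open>i \<noteq> j\<close> by force+
      ultimately have "z \<in> cell (i, j)" "(i, j) \<in> ?J"
        using * i j cellI[of i j s t] by (auto simp: cell_index_def)
      then show ?thesis by (intro UN_I[of "Inr (i, j)"]) auto
    qed
  qed (auto simp: far_def cell_def split: if_splits)
  moreover have "card ?I = 2 + card ?J" using fin by (simp add: card_Plus)
  moreover have "finite ?I" using fin by simp
  ultimately show "betti 0 (top_of_set Z) = enat (2 + card ?J)" "betti 1 (top_of_set Z) = 0"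
    using betti_star_shaped_pieces(2,3)[OF _ ope eq disj star] by simp_all
qed

end

section \<open>The theorem\<close>

lemma card_off_diagonal:
  assumes "finite S"
  shows "card {(i, j). i \<in> S \<and> j \<in> S \<and> i \<noteq> j} = card S * (card S - 1)"
proof -
  have "{(i, j). i \<in> S \<and> j \<in> S \<and> i \<noteq> j} = (SIGMA i:S. S - {i})" by auto
  then show ?thesis using assms by (simp add: card_Diff_singleton)
qed

theorem theorem1p3:
  fixes k :: nat and r L :: real
  assumes "4 \<le> k" and "0 < r" and "0 < L"
  shows "abelian_rank (homology_group 0 (config_space2 (star_hat k L) r)) =
      (if r \<le> 1 then 1
       else if 1 < r \<and> r \<le> 2 \<and> r \<le> L then enat (nat ((int k)\<^sup>2 - 3 * int k + 4))
       else if 1 < r \<and> r \<le> 2 \<and> L < r \<and> r \<le> L + 1 then enat (nat ((int k)\<^sup>2 - int k))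
       else if 1 < r \<and> r \<le> 2 \<and> L + 1 < r then enat (nat ((int k)\<^sup>2 - 3 * int k + 2))
       else if 2 < r \<and> r \<le> L then 2
       else if 2 < r \<and> L < r \<and> r \<le> L + 1 then enat (nat (2 * int k - 2))
       else 0)
    \<and> abelian_rank (homology_group 1 (config_space2 (star_hat k L) r)) =
      (if r \<le> 1 \<and> r \<le> L then enat (nat ((int k)\<^sup>2 - 3 * int k + 1))
       else if r \<le> 1 \<and> L < r \<and> r \<le> L + 1 then enat (nat ((int k)\<^sup>2 - 5 * int k + 5))
       else 0)"
proof -
  define w where "w = (\<lambda>i::nat. if i = 1 then L else 1)"
  have wi: "w i = (if i = 1 then L else 1)" for i by (simp add: w_def)
  interpret star_configuration k w r
    using assms by unfold_locales (auto simp: wi)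
  \<comment> \<open>This makes the truncated differences honest polynomials in \<open>m\<close>; the
    last value below would be negative at k = 3.\<close>
  obtain m where k: "k = m + 4" using assms(1) by (metis add.commute le_Suc_ex)
  \<comment> \<open>The last two right-hand sides are 2n(k - 1) + 1 - (2n + k(k - 1)) for n = k and
    n = k - 1 long arms.\<close>
  have poly: "nat ((int k)\<^sup>2 - 3 * int k + 4) = 2 + (k - 1) * (k - 2)"
    "nat ((int k)\<^sup>2 - int k) = k * (k - 1)"
    "nat ((int k)\<^sup>2 - 3 * int k + 2) = (k - 1) * (k - 2)"
    "nat (2 * int k - 2) = 2 * (k - 1)"
    "nat ((int k)\<^sup>2 - 3 * int k + 1) = 2 * (k * (k - 1)) + 1 - (2 * k + k * (k - 1))"
    "nat ((int k)\<^sup>2 - 5 * int k + 5)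
      = 2 * ((k - 1) * (k - 1)) + 1 - (2 * (k - 1) + k * (k - 1))"
    unfolding k by (auto simp: nat_eq_iff algebra_simps power2_eq_square)
  have cfg: "abelian_rank (homology_group p (config_space2 (star_hat k L) r)) = betti p (top_of_set Z)" for p
    unfolding star_hat_def w_def[symmetric] using assms(1) w_pos
    by (intro betti_homeomorphic_space config_space2_star_homeomorphic) auto
  have range: "{1..k} = insert 1 {2..k}" "card {2..k} = k - 1" using assms(1) by auto
  \<comment> \<open>Two distinct arms have total length 2 or \<open>L + 1\<close>, so here every
    cell is nonempty.\<close>
  have pairs: "card cell_index = k * (k - 1)" if "r \<le> 2" "r \<le> L + 1"
  proof -
    have "cell_index = {(i, j). i \<in> {1..k} \<and> j \<in> {1..k} \<and> i \<noteq> j}"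
      using that by (auto simp: cell_index_def wi)
    then show ?thesis by (simp only: card_off_diagonal[OF finite_atLeastAtMost]) simp
  qed
  have "{(i, j) \<in> cell_index. i \<noteq> 1 \<and> j \<noteq> 1}
      = (if r \<le> 2 then {(i, j). i \<in> {2..k} \<and> j \<in> {2..k} \<and> i \<noteq> j} else {})"
    by (auto simp: cell_index_def wi)
  then have short_pairs: "card {(i, j) \<in> cell_index. i \<noteq> 1 \<and> j \<noteq> 1} = (if r \<le> 2 then (k - 1) * (k - 2) else 0)"
    by (simp only: card_off_diagonal[OF finite_atLeastAtMost] range split: if_split)
      (simp add: numeral_2_eq_2)
  \<comment> \<open>The number of long arms is at least k - 1, exactly one, or zero,
    respectively.\<close>
  consider (near) "r \<le> 1" | (arm) "1 < r" "r \<le> L" | (no_arm) "1 < r" "L < r" by linarith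
  then show ?thesis
  proof cases
    case near
    have long: "long_arms = (if r \<le> L then {1..k} else {2..k})"
      using near assms(1) by (auto simp: long_arms_def wi)
    have "3 \<le> card long_arms" using long assms(1) by auto
    moreover have "\<And>i j. (i, j) \<in> cell_index \<Longrightarrow> i \<in> long_arms \<or> j \<in> long_arms"
      using long by (auto simp: cell_index_def)
    ultimately have betti: "betti 0 (top_of_set Z) = 1" "betti 1 (top_of_set Z)
        = enat (2 * (card long_arms * (k - 1)) + 1 - (2 * card long_arms + card cell_index))"
      using betti_connected by blast+
    have "r \<le> L + 1" "r \<le> 2" using near assms by auto
    then show ?thesis
      unfolding cfg poly using betti near pairs long by auto
  next
    case arm
    have "long_arms = {1}" using arm assms(1) by (auto simp: long_arms_def wi split: if_splits)
    from betti_one_long_arm[OF this] show ?thesis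
      unfolding cfg poly using arm short_pairs by (auto simp: numeral_eq_enat)
  next
    case no_arm
    have "long_arms = {}" using no_arm by (auto simp: long_arms_def wi)
    note betti = betti_no_long_arms[OF this]
    have "card cell_index = (if r \<le> 2 then if r \<le> L + 1 then k * (k - 1) else (k - 1) * (k - 2)
        else if r \<le> L + 1 then 2 * (k - 1) else 0)"
    proof -
      consider "r \<le> 2" "r \<le> L + 1" | "L + 1 < r" | "2 < r" "r \<le> L + 1" by linarith
      then show ?thesis
      proof cases
        case 1
        then show ?thesis using pairs by simp
      next
        case 2
        then have "cell_index = {(i, j) \<in> cell_index. i \<noteq> 1 \<and> j \<noteq> 1}"
          by (auto simp: cell_index_def wi)
        then have "card cell_index = card {(i, j) \<in> cell_index. i \<noteq> 1 \<and> j \<noteq> 1}" by simp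
        then show ?thesis using short_pairs 2 by simp
      next
        case 3
        \<comment> \<open>Two unit arms together are too short, so one of the points lies on arm
          1.\<close>
        then have "cell_index = {1} \<times> {2..k} \<union> {2..k} \<times> {1}"
          using assms(1) by (auto simp: cell_index_def wi split: if_splits)
        moreover have "card ({1} \<times> {2..k} \<union> {2..k} \<times> {1::nat}) = (k - 1) + (k - 1)"
          using range(2) by (subst card_Un_disjoint) (auto simp: card_cartesian_product)
        ultimately show ?thesis using 3 by simp
      qed
    qed
    then show ?thesis
      unfolding cfg poly using betti no_arm by (auto simp: zero_enat_def)
  qed
qed

end
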